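(* Let $\{(U_{k,i}, V_{k,i}); i \geq 1, k \geq 1\}$ be an array of i.i.d. two-dimensional random vectors and let $\{p_n; n \geq 1\}$ be a sequence of positive integers (not necessarily monotone) such that $n/p_n$ is bounded away from $0$ and $\infty$. Let $$T_n = \max_{1 \leq i \neq j \leq p_n} \Big| \sum_{k=1}^n U_{k,i} V_{k,j} \Big|, \quad n \geq 1.$$ (a) If $(EU_{1,1})(EV_{1,1}) = 0$, $(EU_{1,1}^2)(EV_{1,1}^2) = 1$ and $$\sum_{n=1}^{\infty} P\Big(\max_{1 \leq i \neq j \leq n} |U_{1,i} V_{1,j}| \geq \sqrt{n \log n}\Big) < \infty, \qquad ( * )$$ then $$\limsup_{n \to \infty} \frac{T_n}{\sqrt{n \log n}} \leq 2 \quad \text{a.s.}$$ (b) Conversely, if $\limsup_{n \to \infty} T_n/\sqrt{n \log n} < \infty$ a.s., then $(EU_{1,1})(EV_{1,1}) = 0$, $(EU_{1,1}^2)(EV_{1,1}^2) < \infty$ and $( * )$ holds.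
   Context: $\log$ denotes the natural logarithm. *)

theory Defs
  imports "HOL-Probability.Probability"
begin

text \<open>T_n = max over 1 <= i /= j <= p_n of |sum_{k=1}^n U k i * V k j|.
  The maximum over the empty index set (p_n = 1) is taken to be 0
  (irrelevant for the limsup since p_n tends to infinity).\<close>
definition Tstat :: "(nat \<Rightarrow> nat \<Rightarrow> 'a \<Rightarrow> real) \<Rightarrow> (nat \<Rightarrow> nat \<Rightarrow> 'a \<Rightarrow> real)
    \<Rightarrow> (nat \<Rightarrow> nat) \<Rightarrow> nat \<Rightarrow> 'a \<Rightarrow> real" where
  "Tstat U V p n \<omega> = Max (insert 0 {\<bar>\<Sum>k=1..n. U k i \<omega> * V k j \<omega>\<bar> | i j.
       i \<in> {1..p n} \<and> j \<in> {1..p n} \<and> i \<noteq> j})"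

definition Mstat :: "(nat \<Rightarrow> nat \<Rightarrow> 'a \<Rightarrow> real) \<Rightarrow> (nat \<Rightarrow> nat \<Rightarrow> 'a \<Rightarrow> real)
    \<Rightarrow> nat \<Rightarrow> 'a \<Rightarrow> real" where
  "Mstat U V n \<omega> = Max (insert 0 {\<bar>U 1 i \<omega> * V 1 j \<omega>\<bar> | i j.
       i \<in> {1..n} \<and> j \<in> {1..n} \<and> i \<noteq> j})"

end

theory Submission
  imports Defs
begin

text \<open>
  Write $Z = U_{1,1} V_{1,2}$. The maximum in $(*)$ dominates that of $n/2$ independent copies of
  $|Z|$, so $(*)$ gives $P(|Z| \ge y) = O(y^{-8/3})$; moreover $(*)$ is insensitive to constant factors
  in the number of columns and in the threshold, because $n$ columns can be covered by a bounded number
  of pairs of shorter blocks.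

  For (a), truncate every product at the level $b_n = \delta \sqrt{n / \log n}$. For a fixed pair
  $(i,j)$ fewer than ten of the $n$ products exceed $b_n$, up to an event of probability
  $(n P(|Z| \ge b_n))^{10}$, which is summable even after a union bound over the $O(n^2)$ pairs; by $(*)$
  along dyadic blocks all products are eventually at most $\epsilon \sqrt{n \log n}$, so these few
  terms are negligible. The truncated sums obey an exponential bound with the variance of $Z$ in the
  exponent: $P(|S_N| \ge (2+\epsilon) \sqrt{N \log N}) \le 2 N^{-2-\epsilon}$. After the union bound
  over the pairs this is summable along $N = k^\beta$ with $\beta$ large, and between two such times
  the increments run over $o(n)$ rows, so that a crude union bound over all of them suffices.

  For (b), the last row contributes to $T_n$ and not to $T_{n-1}$, so the row maxima are
  $O(\sqrt{n \log n})$ almost surely; they are independent, and the second Borel--Cantelli lemma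
  gives $(*)$. Hence $E Z^2 < \infty$, and Fatou's lemma applied to $(S_n/n - E Z)^2$ together with
  $S_n/n \to 0$ yields $E Z = 0$.
\<close>

subsection \<open>Preliminaries\<close>

text \<open>The constant 2 is where two exponents meet. With exponential tilting by t = alpha
  sqrt(log n / n), a sum of n truncated products exceeds xi sqrt(n log n) with probability about n
  to the power -(alpha xi - alpha^2 / 2). For xi = 2 the best alpha is 2 and the exponent is 2,
  exactly what the union over n^2 pairs consumes. A margin e above 2 leaves only n^(-e), which for
  small e cannot be summed over all n; this forces the passage to a sparse sequence of times. On
  increments of at most eta n rows the tilting costs only eta alpha^2 / 2, so alpha may be large and
  the exponent as big as desired.

  The truncation level is dictated by t: the product t b_n has to stay bounded, and close to 0 where
  the sharp constant is at stake, which leads to b_n of order sqrt(n / log n). This lies below the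
  scale sqrt(n log n) up to which the summability condition controls all products at once, and the
  count of exceptions bridges the gap.\<close>

lemma borel_measurable_fst_real [measurable]: "(fst :: real \<times> real \<Rightarrow> real) \<in> borel_measurable borel"
  by (intro borel_measurable_continuous_onI continuous_intros)

lemma borel_measurable_snd_real [measurable]: "(snd :: real \<times> real \<Rightarrow> real) \<in> borel_measurable borel"
  by (intro borel_measurable_continuous_onI continuous_intros)

lemma measurable_component_fst: "s \<in> K \<Longrightarrow> (\<lambda>w. fst (w s)) \<in> borel_measurable (PiM K (\<lambda>_. borel :: (real \<times> real) measure))"
  by (rule measurable_compose[OF _ borel_measurable_fst_real], rule measurable_component_singleton)

lemma measurable_component_snd: "s \<in> K \<Longrightarrow> (\<lambda>w. snd (w s)) \<in> borel_measurable (PiM K (\<lambda>_. borel :: (real \<times> real) measure))"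
  by (rule measurable_compose[OF _ borel_measurable_snd_real], rule measurable_component_singleton)

definition thr :: "nat \<Rightarrow> real" where
  "thr n = sqrt (real n * ln (real n))"

lemma thr_nonneg: "0 \<le> thr n"
  by (cases "n = 0") (auto simp: thr_def)

lemma thr_mono: "m \<le> n \<Longrightarrow> thr m \<le> thr n"
  by (cases "m = 0"; cases "n = 0") (auto simp: thr_def intro!: mult_mono)

lemma thr_pos: "n \<ge> 2 \<Longrightarrow> 0 < thr n"
  by (auto simp: thr_def)

text \<open>With \<open>a\<close> the fourth root of \<open>x\<close> this rests on 4 (a - 1) <=
  a^2, that is (a - 2)^2 >= 0. Trading the logarithm for a root gives \<open>thr n\<close> <=
  n^(3/4), the origin of the exponent 8/3 in the tail bound.\<close>

lemma ln_le_sqrt: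
  fixes x :: real
  assumes "x > 0"
  shows "ln x \<le> sqrt x"
proof -
  define a where "a = sqrt (sqrt x)"
  have a: "a > 0" "a\<^sup>2 = sqrt x"
    using assms by (auto simp: a_def)
  have "a ^ 4 = (a\<^sup>2)\<^sup>2" by simp
  also have "\<dots> = x" using a(2) assms by simp
  finally have a4: "a ^ 4 = x" .
  have "ln x = 4 * ln a" using a ln_realpow[of a 4] by (simp add: a4)
  also have "\<dots> \<le> 4 * (a - 1)" using ln_le_minus_one[OF a(1)] by simp
  also have "\<dots> \<le> a\<^sup>2" using zero_le_power2[of "a - 2"] by (simp add: power2_diff)
  finally show ?thesis using a by simp
qed

lemma thr_mult_le:
  assumes "c \<ge> 1" "n \<ge> c"
  shows "thr (c * n) \<le> sqrt (2 * real c) * thr n"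
proof -
  have "ln (real (c * n)) = ln (real c) + ln (real n)" using assms by (simp add: ln_mult)
  also have "\<dots> \<le> 2 * ln (real n)" using assms by simp
  finally have "real (c * n) * ln (real (c * n)) \<le> (2 * real c) * (real n * ln (real n))"
    using mult_left_mono[of "ln (real (c * n))" "2 * ln (real n)" "real (c * n)"] by (simp add: algebra_simps)
  then show ?thesis unfolding thr_def by (simp add: real_sqrt_mult[symmetric] del: of_nat_mult)
qed

text \<open>Every value of \<open>f\<close> is repeated \<open>K\<close> times in a row. It is used
  to stretch the index by \<open>K\<close>, which lowers the threshold relative to
  \<open>thr n\<close>.\<close>

lemma summable_div:
  fixes f :: "nat \<Rightarrow> real"
  assumes "summable f" "\<And>n. 0 \<le> f n" "K > 0"
  shows "summable (\<lambda>n. f (n div K))"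
proof (rule summableI_nonneg_bounded[where x = "real K * suminf f"])
  fix n
  have "(\<Sum>i<n. f (i div K)) \<le> (\<Sum>i<n * K. f (i div K))"
    using assms by (intro sum_mono2) (auto simp: Suc_le_eq)
  also have "\<dots> = (\<Sum>m<n. \<Sum>i\<in>{m * K..<m * K + K}. f (i div K))"
    by (rule sum.nat_group[symmetric])
  also have "\<dots> = (\<Sum>m<n. \<Sum>i\<in>{m * K..<m * K + K}. f m)"
  proof (intro sum.cong refl)
    fix m i assume "i \<in> {m * K..<m * K + K}"
    then have "i div K = m" using assms(3) by (intro div_nat_eqI) (auto simp: algebra_simps)
    then show "f (i div K) = f m" by simp
  qed
  also have "\<dots> = real K * (\<Sum>m<n. f m)" by (simp add: sum_distrib_left)
  also have "\<dots> \<le> real K * suminf f"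
    using assms by (intro mult_left_mono sum_le_suminf) auto
  finally show "(\<Sum>i<n. f (i div K)) \<le> real K * suminf f" .
qed (use assms in auto)

subsection \<open>The statistics as maxima\<close>

lemma finite_pairs: "finite {f i j | i j. i \<in> {1..n::nat} \<and> j \<in> {1..n} \<and> i \<noteq> j}"
proof -
  have "{f i j | i j. i \<in> {1..n} \<and> j \<in> {1..n} \<and> i \<noteq> j} \<subseteq> (\<lambda>(i, j). f i j) ` ({1..n} \<times> {1..n})"
    by auto
  then show ?thesis by (rule finite_subset) auto
qed

lemma Tstat_ge:
  "i \<in> {1..p n} \<Longrightarrow> j \<in> {1..p n} \<Longrightarrow> i \<noteq> j \<Longrightarrow> \<bar>\<Sum>k=1..n. U k i \<omega> * V k j \<omega>\<bar> \<le> Tstat U V p n \<omega>"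
  unfolding Tstat_def by (intro Max_ge finite.insertI finite_pairs) blast

lemma Tstat_le:
  assumes "0 \<le> c" "\<And>i j. i \<in> {1..p n} \<Longrightarrow> j \<in> {1..p n} \<Longrightarrow> i \<noteq> j \<Longrightarrow> \<bar>\<Sum>k=1..n. U k i \<omega> * V k j \<omega>\<bar> \<le> c"
  shows "Tstat U V p n \<omega> \<le> c"
  unfolding Tstat_def using assms by (intro Max.boundedI finite.insertI finite_pairs) blast+

lemma le_Mstat_iff:
  assumes "0 < x"
  shows "x \<le> Mstat U V n \<omega> \<longleftrightarrow> (\<exists>i\<in>{1..n}. \<exists>j\<in>{1..n}. i \<noteq> j \<and> x \<le> \<bar>U 1 i \<omega> * V 1 j \<omega>\<bar>)"
proof -
  let ?A = "{\<bar>U 1 i \<omega> * V 1 j \<omega>\<bar> | i j. i \<in> {1..n} \<and> j \<in> {1..n} \<and> i \<noteq> j}"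
  have "x \<le> Mstat U V n \<omega> \<longleftrightarrow> (\<exists>a\<in>insert 0 ?A. x \<le> a)"
    unfolding Mstat_def by (intro Max_ge_iff finite.insertI finite_pairs) blast
  also have "\<dots> \<longleftrightarrow> (\<exists>a\<in>?A. x \<le> a)" using assms by simp
  also have "\<dots> \<longleftrightarrow> (\<exists>i\<in>{1..n}. \<exists>j\<in>{1..n}. i \<noteq> j \<and> x \<le> \<bar>U 1 i \<omega> * V 1 j \<omega>\<bar>)" by blast
  finally show ?thesis .
qed

text \<open>One number \<open>N\<close> serves both as starting index and as constant, so that
  almost sure bounds of this kind become a countable union over a single index.\<close>

lemma limsup_less_infinityE:
  fixes a :: "nat \<Rightarrow> real"
  assumes "limsup (\<lambda>n. ereal (a n / thr n)) < \<infinity>"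
  obtains N :: nat where "\<And>n. n \<ge> N \<Longrightarrow> a n \<le> real N * thr n"
proof -
  obtain c :: real where c: "limsup (\<lambda>n. ereal (a n / thr n)) < ereal c"
    using ereal_dense2[OF assms] by blast
  have "\<forall>\<^sub>F n in sequentially. ereal (a n / thr n) < ereal c" by (rule Limsup_lessD[OF c])
  then obtain N0 where N0: "\<And>n. n \<ge> N0 \<Longrightarrow> a n / thr n < c"
    by (auto simp: eventually_sequentially)
  obtain N1 :: nat where N1: "c \<le> real N1" using real_arch_simple by blast
  define N where "N = N0 + N1 + 2"
  have "a n \<le> real N * thr n" if n: "n \<ge> N" for n
  proof -
    have t: "thr n > 0" using n by (intro thr_pos) (auto simp: N_def)
    have "a n < c * thr n" using N0[of n] n t by (simp add: N_def field_simps)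
    also have "\<dots> \<le> real N * thr n" using N1 t by (intro mult_right_mono) (auto simp: N_def)
    finally show ?thesis by simp
  qed
  then show thesis by (rule that)
qed

lemma thr_div_tendsto_0: "(\<lambda>n. c * thr n / real n) \<longlonglongrightarrow> 0"
proof -
  have "(\<lambda>n::nat. c * (sqrt (real n * ln (real n)) / real n)) \<longlonglongrightarrow> c * 0"
    by (intro tendsto_mult_left) real_asymp
  then show ?thesis by (simp add: thr_def)
qed

subsection \<open>Blocks and truncation\<close>

text \<open>The dyadic blocks tile the positive integers, so a series indexed by blocks is paid for
  by a series indexed by \<open>n\<close>.\<close>

lemma summable_dyadic:
  fixes f h :: "nat \<Rightarrow> real"
  assumes h: "summable h" "\<And>n. 0 \<le> h n" and f: "\<And>m. 0 \<le> f m"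
    and le: "\<And>m. f m \<le> C * (\<Sum>n\<in>{2 ^ m..<2 ^ Suc m}. h n)" and "C \<ge> 0"
  shows "summable f"
proof (rule summableI_nonneg_bounded[OF f])
  fix m
  have "(\<Sum>i<m. \<Sum>n\<in>{2 ^ i..<2 ^ Suc i}. h n) = (\<Sum>n\<in>{1..<2 ^ m}. h n)"
  proof (induction m)
    case (Suc m)
    have "(\<Sum>n\<in>{1..<2 ^ m}. h n) + (\<Sum>n\<in>{2 ^ m..<2 ^ Suc m}. h n) = (\<Sum>n\<in>{1..<2 ^ Suc m}. h n)"
      by (rule sum.atLeastLessThan_concat) auto
    then show ?case using Suc by simp
  qed simp
  moreover have "(\<Sum>i<m. f i) \<le> (\<Sum>i<m. C * (\<Sum>n\<in>{2 ^ i..<2 ^ Suc i}. h n))"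
    by (intro sum_mono le)
  ultimately have "(\<Sum>i<m. f i) \<le> C * (\<Sum>n\<in>{1..<2 ^ m}. h n)"
    by (simp add: sum_distrib_left[symmetric] del: One_nat_def power_Suc)
  also have "\<dots> \<le> C * suminf h"
    using h \<open>C \<ge> 0\<close> by (intro mult_left_mono sum_le_suminf) auto
  finally show "(\<Sum>i<m. f i) \<le> C * suminf h" .
qed

text \<open>Taylor's formula with Lagrange remainder. The factor 1/2 is kept exact because it
  decides the constant 2 of the result; the exponential factor will be bounded through the
  truncation.\<close>

lemma exp_le_quadratic: "exp y \<le> 1 + y + y\<^sup>2 / 2 * exp \<bar>y\<bar>" for y :: real
proof -
  obtain t where t: "\<bar>t\<bar> \<le> \<bar>y\<bar>" "exp y = (\<Sum>m<2. y ^ m / fact m) + exp t / fact 2 * y ^ 2"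
    using Maclaurin_exp_le[of y 2] by blast
  have "exp y = 1 + y + y\<^sup>2 / 2 * exp t" using t(2) by (simp add: numeral_2_eq_2)
  also have "\<dots> \<le> 1 + y + y\<^sup>2 / 2 * exp \<bar>y\<bar>"
    using t(1) by (intro add_left_mono mult_left_mono) auto
  finally show ?thesis .
qed

text \<open>Large values become 0 instead of being clipped at \<open>b\<close>: what truncation
  removes from a sum is then exactly the sum of its large terms.\<close>

definition trunc :: "real \<Rightarrow> real \<Rightarrow> real" where
  "trunc b z = (if \<bar>z\<bar> < b then z else 0)"

lemma measurable_trunc [measurable]: "trunc b \<in> borel_measurable borel"
  unfolding trunc_def[abs_def] by measurable

lemma abs_trunc_le: "0 \<le> b \<Longrightarrow> \<bar>trunc b z\<bar> \<le> b" and trunc_sq_le: "(trunc b z)\<^sup>2 \<le> z\<^sup>2"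
  by (auto simp: trunc_def)

lemma ex_root_interval:
  fixes n :: nat
  assumes "\<beta> \<ge> 1"
  obtains k where "k ^ \<beta> \<le> n" "n < (k + 1) ^ \<beta>"
proof -
  have "n + 1 \<le> (n + 1) ^ \<beta>" using assms by (intro self_le_power) auto
  then have ex: "\<exists>m. n < m ^ \<beta>" by (intro exI[of _ "n + 1"]) simp
  define m where "m = (LEAST m. n < m ^ \<beta>)"
  have m: "n < m ^ \<beta>" unfolding m_def by (rule LeastI_ex[OF ex])
  then have "m \<noteq> 0" using assms by (intro notI) (simp add: power_0_left)
  moreover have "\<not> n < (m - 1) ^ \<beta>" using not_less_Least[of "m - 1" "\<lambda>m. n < m ^ \<beta>"] \<open>m \<noteq> 0\<close> by (simp add: m_def)
  ultimately show thesis using m by (intro that[of "m - 1"]) auto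
qed

text \<open>The exceptions are counted in all of \<open>{1..n}\<close> although the sum runs over
  \<open>S\<close>, so the count at time \<open>n\<close> applies to an increment as well as to a
  full sum.\<close>

lemma abs_sum_le_trunc:
  fixes z :: "nat \<Rightarrow> real"
  assumes "S \<subseteq> {1..n}" "\<And>l. l \<in> S \<Longrightarrow> \<bar>z l\<bar> \<le> B" "card {l\<in>{1..n}. b \<le> \<bar>z l\<bar>} \<le> r" "B \<ge> 0"
  shows "\<bar>\<Sum>l\<in>S. z l\<bar> \<le> \<bar>\<Sum>l\<in>S. trunc b (z l)\<bar> + real r * B"
proof -
  have S: "finite S" using assms(1) finite_subset by blast
  have "(\<Sum>l\<in>S. z l) = (\<Sum>l\<in>S. trunc b (z l) + (if b \<le> \<bar>z l\<bar> then z l else 0))"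
    by (intro sum.cong) (auto simp: trunc_def)
  also have "\<dots> = (\<Sum>l\<in>S. trunc b (z l)) + (\<Sum>l | l \<in> S \<and> b \<le> \<bar>z l\<bar>. z l)"
    using S by (simp add: sum.distrib sum.inter_filter)
  finally have "\<bar>\<Sum>l\<in>S. z l\<bar> \<le> \<bar>\<Sum>l\<in>S. trunc b (z l)\<bar> + \<bar>\<Sum>l | l \<in> S \<and> b \<le> \<bar>z l\<bar>. z l\<bar>" by linarith
  moreover have "\<bar>\<Sum>l | l \<in> S \<and> b \<le> \<bar>z l\<bar>. z l\<bar> \<le> real r * B"
  proof -
    have "\<bar>\<Sum>l | l \<in> S \<and> b \<le> \<bar>z l\<bar>. z l\<bar> \<le> (\<Sum>l | l \<in> S \<and> b \<le> \<bar>z l\<bar>. \<bar>z l\<bar>)" by (rule sum_abs)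
    also have "\<dots> \<le> real (card {l. l \<in> S \<and> b \<le> \<bar>z l\<bar>}) * B"
      using assms(2) by (intro sum_bounded_above) auto
    also have "\<dots> \<le> real r * B"
    proof (intro mult_right_mono)
      have "card {l. l \<in> S \<and> b \<le> \<bar>z l\<bar>} \<le> card {l\<in>{1..n}. b \<le> \<bar>z l\<bar>}"
        using assms(1) by (intro card_mono) auto
      then show "real (card {l. l \<in> S \<and> b \<le> \<bar>z l\<bar>}) \<le> real r" using assms(3) by linarith
    qed fact
    finally show ?thesis .
  qed
  ultimately show ?thesis by linarith
qed

subsection \<open>Arrays of independent identically distributed pairs\<close>

text \<open>Independence holds between pairs, not inside a pair: \<open>U k i\<close> and
  \<open>V k i\<close> may depend on each other. Only products across two different columns have
  independent factors for certain.\<close>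

locale iid_pairs = prob_space M for M :: "'a measure" +
  fixes U V :: "nat \<Rightarrow> nat \<Rightarrow> 'a \<Rightarrow> real"
  assumes indep: "indep_vars (\<lambda>_. borel)
      (\<lambda>ki \<omega>. (U (fst ki) (snd ki) \<omega>, V (fst ki) (snd ki) \<omega>)) ({1..} \<times> {1..})"
    and ident: "\<And>k i. k \<ge> 1 \<Longrightarrow> i \<ge> 1 \<Longrightarrow>
      distr M borel (\<lambda>\<omega>. (U k i \<omega>, V k i \<omega>)) = distr M borel (\<lambda>\<omega>. (U 1 1 \<omega>, V 1 1 \<omega>))"
begin

definition X :: "nat \<times> nat \<Rightarrow> 'a \<Rightarrow> real \<times> real" where
  "X s \<omega> = (U (fst s) (snd s) \<omega>, V (fst s) (snd s) \<omega>)"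

lemma indep_X: "indep_vars (\<lambda>_. borel) X ({1..} \<times> {1..})"
  using indep unfolding X_def[abs_def] .

lemma measurable_X: "k \<ge> 1 \<Longrightarrow> i \<ge> 1 \<Longrightarrow> X (k, i) \<in> borel_measurable M"
  using indep_X unfolding indep_vars_def by auto

lemma measurable_X': "s \<in> {1..} \<times> {1..} \<Longrightarrow> X s \<in> borel_measurable M"
  using measurable_X[of "fst s" "snd s"] by (cases s) auto

lemma measurable_U: "k \<ge> 1 \<Longrightarrow> i \<ge> 1 \<Longrightarrow> U k i \<in> borel_measurable M"
  using measurable_compose[OF measurable_X borel_measurable_fst_real, of k i] by (simp add: X_def)

lemma measurable_V: "k \<ge> 1 \<Longrightarrow> i \<ge> 1 \<Longrightarrow> V k i \<in> borel_measurable M"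
  using measurable_compose[OF measurable_X borel_measurable_snd_real, of k i] by (simp add: X_def)

lemma measurable_UV: "k \<ge> 1 \<Longrightarrow> i \<ge> 1 \<Longrightarrow> j \<ge> 1 \<Longrightarrow> (\<lambda>\<omega>. U k i \<omega> * V k j \<omega>) \<in> borel_measurable M"
  using measurable_U measurable_V by simp

text \<open>The right-hand side does not mention \<open>t\<close>: every injective choice of indices
  has the same joint law, so events can be moved between rows and columns. Independence yields the
  product measure over the image of \<open>t\<close>, which is then pulled back along
  \<open>t\<close>.\<close>

lemma distr_subfamily:
  assumes "finite I" "I \<noteq> {}" "inj_on t I" "t ` I \<subseteq> {1..} \<times> {1..}"
  shows "distr M (PiM I (\<lambda>_. borel)) (\<lambda>\<omega>. \<lambda>i\<in>I. X (t i) \<omega>) = PiM I (\<lambda>_. distr M borel (X (1,1)))"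
proof -
  let ?S = "t ` I" and ?\<mu> = "distr M borel (X (1,1))"
  have rv: "random_variable borel (X s)" if "s \<in> ?S" for s
    using that assms(4) measurable_X[of "fst s" "snd s"] by (cases s) auto
  have mu: "distr M borel (X s) = ?\<mu>" if "s \<in> ?S" for s
    using that assms(4) ident[of "fst s" "snd s"] by (cases s) (auto simp: X_def[abs_def])
  have X11: "X (1,1) \<in> borel_measurable M" by (rule measurable_X) auto
  interpret mu: prob_space ?\<mu> by (rule prob_space_distr[OF X11])
  interpret P: product_prob_space "\<lambda>_. ?\<mu>" ?S ..
  have 1: "distr M (PiM ?S (\<lambda>_. borel)) (\<lambda>\<omega>. \<lambda>s\<in>?S. X s \<omega>) = PiM ?S (\<lambda>_. ?\<mu>)"
  proof -
    have "indep_vars (\<lambda>_. borel) X ?S" by (rule indep_vars_subset[OF indep_X assms(4)])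
    then have "distr M (PiM ?S (\<lambda>_. borel)) (\<lambda>\<omega>. \<lambda>s\<in>?S. X s \<omega>) = (\<Pi>\<^sub>M s\<in>?S. distr M borel (X s))"
      using assms(2) by (subst (asm) indep_vars_iff_distr_eq_PiM') (auto intro: rv)
    also have "\<dots> = PiM ?S (\<lambda>_. ?\<mu>)" by (rule PiM_cong) (auto simp: mu)
    finally show ?thesis .
  qed
  have 2: "distr (PiM ?S (\<lambda>_. ?\<mu>)) (PiM I (\<lambda>_. ?\<mu>)) (\<lambda>w. \<lambda>i\<in>I. w (t i)) = PiM I (\<lambda>_. ?\<mu>)"
    by (rule P.distr_reorder) (use assms in auto)
  have setsI: "sets (PiM I (\<lambda>_. ?\<mu>)) = sets (PiM I (\<lambda>_. borel))" by (rule sets_PiM_cong) auto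
  have m1: "(\<lambda>\<omega>. \<lambda>s\<in>?S. X s \<omega>) \<in> measurable M (PiM ?S (\<lambda>_. borel))"
    by (intro measurable_restrict rv)
  have m2: "(\<lambda>w. \<lambda>i\<in>I. w (t i)) \<in> measurable (PiM ?S (\<lambda>_. borel)) (PiM I (\<lambda>_. borel :: (real\<times>real) measure))"
    by (intro measurable_restrict measurable_component_singleton) auto
  have "PiM I (\<lambda>_. ?\<mu>) = distr (PiM ?S (\<lambda>_. ?\<mu>)) (PiM I (\<lambda>_. borel)) (\<lambda>w. \<lambda>i\<in>I. w (t i))"
    by (rule trans[OF 2[symmetric] distr_cong[OF refl setsI refl]])
  also have "\<dots> = distr (distr M (PiM ?S (\<lambda>_. borel)) (\<lambda>\<omega>. \<lambda>s\<in>?S. X s \<omega>)) (PiM I (\<lambda>_. borel)) (\<lambda>w. \<lambda>i\<in>I. w (t i))"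
    by (simp only: 1)
  also have "\<dots> = distr M (PiM I (\<lambda>_. borel)) ((\<lambda>w. \<lambda>i\<in>I. w (t i)) \<circ> (\<lambda>\<omega>. \<lambda>s\<in>?S. X s \<omega>))"
    by (rule distr_distr[OF m2 m1])
  also have "\<dots> = distr M (PiM I (\<lambda>_. borel)) (\<lambda>\<omega>. \<lambda>i\<in>I. X (t i) \<omega>)"
    by (rule distr_cong) (auto simp: fun_eq_iff)
  finally show ?thesis ..
qed

subsection \<open>Row maxima\<close>

text \<open>\<open>Mstat\<close> concerns row 1 and an initial segment of columns; the proof also
  needs other rows (the last row of a sum) and other column sets (blocks). Phrased as an event about
  pairs, it does not involve the default value 0 of the maximum.\<close>

definition rowmax_ev :: "nat \<Rightarrow> nat set \<Rightarrow> real \<Rightarrow> 'a set" where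
  "rowmax_ev k S x = {\<omega> \<in> space M. \<exists>i\<in>S. \<exists>j\<in>S. i \<noteq> j \<and> x \<le> \<bar>U k i \<omega> * V k j \<omega>\<bar>}"

definition rowmax_prob :: "nat \<Rightarrow> real \<Rightarrow> real" where
  "rowmax_prob n x = prob (rowmax_ev 1 {1..n} x)"

lemma rowmax_ev_sets: "k \<ge> 1 \<Longrightarrow> finite S \<Longrightarrow> S \<subseteq> {1..} \<Longrightarrow> rowmax_ev k S x \<in> sets M"
proof -
  assume a: "k \<ge> 1" "finite S" "S \<subseteq> {1..}"
  have "rowmax_ev k S x = (\<Union>i\<in>S. \<Union>j\<in>{j\<in>S. i \<noteq> j}. {\<omega> \<in> space M. x \<le> \<bar>U k i \<omega> * V k j \<omega>\<bar>})"
    by (auto simp: rowmax_ev_def)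
  also have "\<dots> \<in> sets M"
  proof (intro sets.finite_UN)
    fix i j assume "i \<in> S" "j \<in> {j\<in>S. i \<noteq> j}"
    then have [measurable]: "U k i \<in> borel_measurable M" "V k j \<in> borel_measurable M"
      using a by (auto intro!: measurable_U measurable_V)
    show "{\<omega> \<in> space M. x \<le> \<bar>U k i \<omega> * V k j \<omega>\<bar>} \<in> sets M" by measurable
  qed (use a in auto)
  finally show ?thesis .
qed

text \<open>Both sides are the measure of one set under the same product measure, reindexed by an
  enumeration of the columns.\<close>

lemma prob_rowmax_ev_card:
  assumes "k \<ge> 1" "finite S" "S \<subseteq> {1..}"
  shows "prob (rowmax_ev k S x) = rowmax_prob (card S) x"
proof (cases "S = {}")
  case True
  then show ?thesis by (simp add: rowmax_prob_def rowmax_ev_def)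
next
  case False
  define I where "I = {1..card S}"
  let ?\<mu> = "distr M borel (X (1,1))"
  let ?N = "PiM I (\<lambda>_. borel :: (real\<times>real) measure)"
  obtain g where g: "bij_betw g I S"
    using finite_same_card_bij[of I S] assms by (auto simp: I_def)
  have I: "finite I" "I \<noteq> {}" using False assms(2) by (auto simp: I_def Suc_le_eq card_gt_0_iff)
  define A where "A = {w \<in> space ?N. \<exists>i\<in>I. \<exists>j\<in>I. i \<noteq> j \<and> x \<le> \<bar>fst (w i) * snd (w j)\<bar>}"
  have A: "A \<in> sets ?N"
  proof -
    have "A = (\<Union>i\<in>I. \<Union>j\<in>{j\<in>I. i \<noteq> j}. {w \<in> space ?N. x \<le> \<bar>fst (w i) * snd (w j)\<bar>})"
      by (auto simp: A_def)
    also have "\<dots> \<in> sets ?N"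
    proof (intro sets.finite_UN)
      fix i j assume ij: "i \<in> I" "j \<in> {j\<in>I. i \<noteq> j}"
      have [measurable]: "(\<lambda>w. fst (w i)) \<in> borel_measurable ?N"
        by (rule measurable_compose[OF _ borel_measurable_fst_real], rule measurable_component_singleton)
          (use ij in auto)
      have [measurable]: "(\<lambda>w. snd (w j)) \<in> borel_measurable ?N"
        by (rule measurable_compose[OF _ borel_measurable_snd_real], rule measurable_component_singleton)
          (use ij in auto)
      show "{w \<in> space ?N. x \<le> \<bar>fst (w i) * snd (w j)\<bar>} \<in> sets ?N" by measurable
    qed (use I in auto)
    finally show ?thesis .
  qed
  have *: "prob {\<omega> \<in> space M. (\<lambda>i\<in>I. X (t i) \<omega>) \<in> A} = measure (PiM I (\<lambda>_. ?\<mu>)) A"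
    if t: "inj_on t I" "t ` I \<subseteq> {1..} \<times> {1..}" for t
  proof -
    have m: "(\<lambda>\<omega>. \<lambda>i\<in>I. X (t i) \<omega>) \<in> measurable M ?N"
      by (intro measurable_restrict) (use t(2) in \<open>auto intro!: measurable_X'\<close>)
    show ?thesis
      by (subst distr_subfamily[OF I t, symmetric], subst measure_distr[OF m A])
        (auto intro!: arg_cong[where f=prob])
  qed
  have "rowmax_ev k S x = {\<omega> \<in> space M. (\<lambda>i\<in>I. X (k, g i) \<omega>) \<in> A}"
  proof -
    have S: "S = g ` I" using g by (auto simp: bij_betw_def)
    have "(i \<noteq> j) = (g i \<noteq> g j)" if "i \<in> I" "j \<in> I" for i j
      using g that by (auto simp: bij_betw_def inj_on_def)
    then have "(\<exists>i\<in>S. \<exists>j\<in>S. i \<noteq> j \<and> Q i j) \<longleftrightarrow> (\<exists>i\<in>I. \<exists>j\<in>I. i \<noteq> j \<and> Q (g i) (g j))" for Q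
      unfolding S by (simp cong: bex_cong)
    then show ?thesis
      by (auto simp: rowmax_ev_def A_def space_PiM PiE_def X_def)
  qed
  moreover have "rowmax_ev 1 I x = {\<omega> \<in> space M. (\<lambda>i\<in>I. X (1, i) \<omega>) \<in> A}"
    unfolding rowmax_ev_def A_def by (auto simp: space_PiM PiE_def X_def)
  moreover have "inj_on (\<lambda>i. (k, g i)) I" "(\<lambda>i. (k, g i)) ` I \<subseteq> {1..} \<times> {1..}"
    using g assms by (auto simp: bij_betw_def inj_on_def)
  moreover have "inj_on (\<lambda>i. (1::nat, i)) I" "(\<lambda>i. (1::nat, i)) ` I \<subseteq> {1..} \<times> {1..}"
    by (auto simp: inj_on_def I_def)
  ultimately show ?thesis
    unfolding rowmax_prob_def I_def[symmetric] by (simp only: *)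
qed

lemma rowmax_prob_mono: "n \<le> m \<Longrightarrow> y \<le> x \<Longrightarrow> rowmax_prob n x \<le> rowmax_prob m y"
  unfolding rowmax_prob_def
  by (intro finite_measure_mono rowmax_ev_sets) (fastforce simp: rowmax_ev_def)+

lemma rowmax_prob_nonneg: "0 \<le> rowmax_prob n x"
  by (simp add: rowmax_prob_def)

text \<open>The event involves pairs of columns, so a union bound over blocks has to run over pairs
  of blocks. The price is quadratic in their number, but still a constant.\<close>

lemma rowmax_prob_subadd:
  assumes "n \<le> J * n'" "n' \<ge> 2"
  shows "rowmax_prob n x \<le> (3 * real J)\<^sup>2 * rowmax_prob n' x"
proof -
  \<comment> \<open>Any two blocks of \<open>h\<close> columns together have at most \<open>n'\<close> columns.\<close>
  define h where "h = n' div 2"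
  \<comment> \<open>The factor 3 is attained at \<open>n' = 3\<close>, where \<open>h = 1\<close>.
    It makes \<open>3 * J\<close> blocks of length \<open>h\<close> cover \<open>J * n'\<close>
    columns.\<close>
  have h: "h \<ge> 1" "2 * h \<le> n'" "n' \<le> 3 * h" using assms(2) by (auto simp: h_def)
  define B where "B = (\<lambda>a. {a * h + 1..(a + 1) * h})"
  have card_B: "card (B a) = h" for a by (simp add: B_def)
  have B_sub: "B a \<union> B b \<subseteq> {1..}" "finite (B a \<union> B b)" for a b by (auto simp: B_def)
  have "n \<le> (3 * J) * h"
  proof -
    have "J * n' \<le> J * (3 * h)" using h(3) by (intro mult_left_mono) auto
    also have "\<dots> = (3 * J) * h" by simp
    finally show ?thesis using assms(1) by linarith
  qed
  have cover: "\<exists>a<3*J. i \<in> B a" if "i \<in> {1..n}" for i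
  proof (intro exI conjI)
    have "i - 1 < (3 * J) * h" using that \<open>n \<le> (3 * J) * h\<close> by auto
    then show "(i - 1) div h < 3 * J" using h(1) by (simp add: div_less_iff_less_mult)
    have "(i - 1) div h * h + (i - 1) mod h = i - 1" by simp
    moreover have "(i - 1) mod h < h" using h(1) by simp
    ultimately have "(i - 1) div h * h + 1 \<le> i" "i \<le> (i - 1) div h * h + h" using that unfolding atLeastAtMost_iff by linarith+
    then show "i \<in> B ((i - 1) div h)" unfolding B_def by simp
  qed
  have "rowmax_ev 1 {1..n} x \<subseteq> (\<Union>ab\<in>{..<3*J}\<times>{..<3*J}. rowmax_ev 1 (B (fst ab) \<union> B (snd ab)) x)"
  proof
    fix \<omega> assume "\<omega> \<in> rowmax_ev 1 {1..n} x"
    then obtain i j where ij: "i \<in> {1..n}" "j \<in> {1..n}" "i \<noteq> j" "x \<le> \<bar>U 1 i \<omega> * V 1 j \<omega>\<bar>" "\<omega> \<in> space M"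
      by (auto simp: rowmax_ev_def)
    obtain a b where "a < 3 * J" "i \<in> B a" "b < 3 * J" "j \<in> B b" using cover ij(1,2) by blast
    with ij show "\<omega> \<in> (\<Union>ab\<in>{..<3*J}\<times>{..<3*J}. rowmax_ev 1 (B (fst ab) \<union> B (snd ab)) x)"
      by (intro UN_I[of "(a,b)"]) (auto simp: rowmax_ev_def)
  qed
  then have "rowmax_prob n x \<le> prob (\<Union>ab\<in>{..<3*J}\<times>{..<3*J}. rowmax_ev 1 (B (fst ab) \<union> B (snd ab)) x)"
    unfolding rowmax_prob_def using B_sub
    by (intro finite_measure_mono sets.finite_UN rowmax_ev_sets) auto
  also have "\<dots> \<le> (\<Sum>ab\<in>{..<3*J}\<times>{..<3*J}. prob (rowmax_ev 1 (B (fst ab) \<union> B (snd ab)) x))"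
    using B_sub by (intro measure_UNION_le rowmax_ev_sets) auto
  also have "\<dots> \<le> (\<Sum>ab\<in>{..<3*J}\<times>{..<3*J}. rowmax_prob n' x)"
  proof (rule sum_mono)
    fix ab
    have "card (B (fst ab) \<union> B (snd ab)) \<le> n'"
      using card_Un_le[of "B (fst ab)" "B (snd ab)"] h by (simp add: card_B)
    then show "prob (rowmax_ev 1 (B (fst ab) \<union> B (snd ab)) x) \<le> rowmax_prob n' x"
      using B_sub by (subst prob_rowmax_ev_card) (auto intro!: rowmax_prob_mono)
  qed
  also have "\<dots> = (3 * real J)\<^sup>2 * rowmax_prob n' x" by (simp add: power2_eq_square)
  finally show ?thesis .
qed

subsection \<open>Products of entries from different columns\<close>

lemma indep_vars_functional:
  fixes f :: "'i \<Rightarrow> (nat \<times> nat \<Rightarrow> real \<times> real) \<Rightarrow> real"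
  assumes "\<And>l. l \<in> L \<Longrightarrow> K l \<subseteq> {1..} \<times> {1..}" "disjoint_family_on K L"
    and "\<And>l. l \<in> L \<Longrightarrow> f l \<in> borel_measurable (PiM (K l) (\<lambda>_. borel))"
  shows "indep_vars (\<lambda>_. borel) (\<lambda>l \<omega>. f l (\<lambda>s\<in>K l. X s \<omega>)) L"
  by (rule indep_vars_compose2[OF indep_vars_restrict[OF indep_X assms(1,2)] assms(3)])

text \<open>Serves two directions: two fixed columns with varying rows, for the sums, and disjoint
  pairs of columns inside row 1, for the lower bound on row maxima.\<close>

lemma indep_products:
  assumes "\<And>l. l \<in> L \<Longrightarrow> a l \<ge> 1 \<and> b l \<ge> 1 \<and> c l \<ge> 1"
    and "disjoint_family_on (\<lambda>l. {(a l, b l), (a l, c l)}) L"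
  shows "indep_vars (\<lambda>_. borel) (\<lambda>l \<omega>. U (a l) (b l) \<omega> * V (a l) (c l) \<omega>) L"
proof -
  have "indep_vars (\<lambda>_. borel) (\<lambda>l \<omega>. (\<lambda>w. fst (w (a l, b l)) * snd (w (a l, c l)))
      (\<lambda>s\<in>{(a l, b l), (a l, c l)}. X s \<omega>)) L"
  proof (rule indep_vars_functional)
    fix l assume "l \<in> L"
    show "(\<lambda>w. fst (w (a l, b l)) * snd (w (a l, c l)) :: real)
        \<in> borel_measurable (PiM {(a l, b l), (a l, c l)} (\<lambda>_. borel))"
      by (rule borel_measurable_times; rule measurable_component_fst measurable_component_snd) auto
  qed (use assms in auto)
  then show ?thesis by (simp add: X_def)
qed

lemma indep_products_rows:
  "i \<ge> 1 \<Longrightarrow> j \<ge> 1 \<Longrightarrow> indep_vars (\<lambda>_. borel) (\<lambda>k \<omega>. U k i \<omega> * V k j \<omega>) {1..}"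
  by (rule indep_products) (auto simp: disjoint_family_on_def)

lemma indep_products_columns:
  "indep_vars (\<lambda>_. borel) (\<lambda>l \<omega>. U 1 (2 * l + 1) \<omega> * V 1 (2 * l + 2) \<omega>) UNIV"
proof (rule indep_products)
  show "disjoint_family (\<lambda>l :: nat. {(1 :: nat, 2 * l + 1), (1, 2 * l + 2)})"
    unfolding disjoint_family_on_def by (auto; presburger)
qed auto

text \<open>Different rows use disjoint sets of pairs. The events enter as the zero sets of the real
  functions \<open>F n\<close>, because independence was set up for real functionals of blocks of
  pairs.\<close>

lemma prob_no_rowmax:
  assumes L: "finite L" "L \<noteq> {}" and S: "\<And>n. n \<in> L \<Longrightarrow> n \<ge> 1 \<and> finite (S n) \<and> S n \<subseteq> {1..}"
  shows "prob (\<Inter>n\<in>L. space M - rowmax_ev n (S n) (x n)) = (\<Prod>n\<in>L. 1 - prob (rowmax_ev n (S n) (x n)))"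
proof -
  define A where "A = (\<lambda>n. {w \<in> space (PiM ({n} \<times> S n) (\<lambda>_. borel)).
      \<exists>i\<in>S n. \<exists>j\<in>S n. i \<noteq> j \<and> x n \<le> \<bar>fst (w (n, i) :: real \<times> real) * snd (w (n, j) :: real \<times> real)\<bar>})"
  have A: "A n \<in> sets (PiM ({n} \<times> S n) (\<lambda>_. borel))" if n: "n \<in> L" for n
  proof -
    let ?N = "PiM ({n} \<times> S n) (\<lambda>_. borel :: (real \<times> real) measure)"
    have "A n = (\<Union>i\<in>S n. \<Union>j\<in>{j\<in>S n. i \<noteq> j}. {w \<in> space ?N. x n \<le> \<bar>fst (w (n, i)) * snd (w (n, j))\<bar>})"
      by (auto simp: A_def)
    also have "\<dots> \<in> sets ?N"
    proof (intro sets.finite_UN)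
      fix i j assume ij: "i \<in> S n" "j \<in> {j\<in>S n. i \<noteq> j}"
      have [measurable]: "(\<lambda>w. fst (w (n, i))) \<in> borel_measurable ?N"
        by (rule measurable_component_fst) (use ij in auto)
      have [measurable]: "(\<lambda>w. snd (w (n, j))) \<in> borel_measurable ?N"
        by (rule measurable_component_snd) (use ij in auto)
      show "{w \<in> space ?N. x n \<le> \<bar>fst (w (n, i)) * snd (w (n, j))\<bar>} \<in> sets ?N" by measurable
    qed (use S[OF n] in auto)
    finally show ?thesis .
  qed
  define F where "F = (\<lambda>n \<omega>. (indicator (A n) :: _ \<Rightarrow> real) (\<lambda>s\<in>{n} \<times> S n. X s \<omega>))"
  have F: "indep_vars (\<lambda>_. borel) F L"
    unfolding F_def
  proof (rule indep_vars_functional)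
    fix n assume "n \<in> L"
    show "(indicator (A n) :: _ \<Rightarrow> real) \<in> borel_measurable (PiM ({n} \<times> S n) (\<lambda>_. borel))"
      using A[OF \<open>n \<in> L\<close>] by simp
    show "{n} \<times> S n \<subseteq> {1..} \<times> {1..}" using S[OF \<open>n \<in> L\<close>] by auto
  qed (auto simp: disjoint_family_on_def)
  have eq: "F n -` {0} \<inter> space M = space M - rowmax_ev n (S n) (x n)" for n
  proof -
    define Q where "Q = (\<lambda>\<omega>. \<exists>i\<in>S n. \<exists>j\<in>S n. i \<noteq> j \<and> x n \<le> \<bar>U n i \<omega> * V n j \<omega>\<bar>)"
    have "(\<lambda>s\<in>{n} \<times> S n. X s \<omega>) \<in> A n \<longleftrightarrow> Q \<omega>" for \<omega>
      by (simp add: A_def Q_def X_def space_PiM cong: bex_cong)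
    moreover have "rowmax_ev n (S n) (x n) = {\<omega> \<in> space M. Q \<omega>}"
      by (simp add: rowmax_ev_def Q_def)
    ultimately show ?thesis unfolding F_def by (auto simp: indicator_def)
  qed
  have "prob (\<Inter>n\<in>L. F n -` {0} \<inter> space M) = (\<Prod>n\<in>L. prob (F n -` {0} \<inter> space M))"
    by (rule indep_varsD_finite[OF F L(2,1)]) auto
  also have "\<dots> = (\<Prod>n\<in>L. 1 - prob (rowmax_ev n (S n) (x n)))"
    unfolding eq by (intro prod.cong prob_compl rowmax_ev_sets refl) (use S in auto)
  finally show ?thesis by (simp only: eq)
qed

text \<open>The two-index case of the reindexing principle, with 1 and 2 sent to
  \<open>(k, i)\<close> and \<open>(k, j)\<close>; injectivity is where \<open>i \<noteq> j\<close>
  enters.\<close>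

lemma distr_product:
  assumes "k \<ge> 1" "i \<ge> 1" "j \<ge> 1" "i \<noteq> j"
  shows "distr M borel (\<lambda>\<omega>. U k i \<omega> * V k j \<omega>) = distr M borel (\<lambda>\<omega>. U 1 1 \<omega> * V 1 2 \<omega>)"
proof -
  let ?I = "{1, 2 :: nat}" and ?\<mu> = "distr M borel (X (1,1))"
  let ?N = "PiM ?I (\<lambda>_. borel :: (real\<times>real) measure)"
  define f where "f = (\<lambda>w. fst (w 1 :: real \<times> real) * snd (w (2::nat) :: real \<times> real))"
  have f: "f \<in> borel_measurable ?N"
    unfolding f_def
    by (intro borel_measurable_times measurable_compose[OF _ borel_measurable_fst_real]
        measurable_compose[OF _ borel_measurable_snd_real] measurable_component_singleton) auto
  have *: "distr M borel (\<lambda>\<omega>. f (\<lambda>n\<in>?I. X (t n) \<omega>)) = distr (PiM ?I (\<lambda>_. ?\<mu>)) borel f"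
    if t: "inj_on t ?I" "t ` ?I \<subseteq> {1..} \<times> {1..}" for t
  proof -
    have m: "(\<lambda>\<omega>. \<lambda>n\<in>?I. X (t n) \<omega>) \<in> measurable M ?N"
      by (intro measurable_restrict) (use t(2) in \<open>auto intro!: measurable_X'\<close>)
    have "distr (PiM ?I (\<lambda>_. ?\<mu>)) borel f = distr (distr M ?N (\<lambda>\<omega>. \<lambda>n\<in>?I. X (t n) \<omega>)) borel f"
      by (subst distr_subfamily[OF _ _ t]) auto
    also have "\<dots> = distr M borel (f \<circ> (\<lambda>\<omega>. \<lambda>n\<in>?I. X (t n) \<omega>))"
      by (rule distr_distr[OF f m])
    finally show ?thesis by (simp only: o_def)
  qed
  have "distr M borel (\<lambda>\<omega>. f (\<lambda>n\<in>?I. X ((\<lambda>n. if n = 1 then (k, i) else (k, j)) n) \<omega>)) = distr (PiM ?I (\<lambda>_. ?\<mu>)) borel f"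
    by (rule *) (use assms in \<open>auto simp: inj_on_def\<close>)
  moreover have "distr M borel (\<lambda>\<omega>. f (\<lambda>n\<in>?I. X ((\<lambda>n. (1, n)) n) \<omega>)) = distr (PiM ?I (\<lambda>_. ?\<mu>)) borel f"
    by (rule *) (auto simp: inj_on_def)
  ultimately show ?thesis by (simp add: f_def X_def)
qed

lemma prob_product:
  assumes "k \<ge> 1" "i \<ge> 1" "j \<ge> 1" "i \<noteq> j" and [measurable]: "Measurable.pred borel P"
  shows "prob {\<omega> \<in> space M. P (U k i \<omega> * V k j \<omega>)} = prob {\<omega> \<in> space M. P (U 1 1 \<omega> * V 1 2 \<omega>)}"
proof -
  have *: "prob {\<omega> \<in> space M. P (Y \<omega>)} = measure (distr M borel Y) {z. P z}"
    if [measurable]: "Y \<in> borel_measurable M" for Y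
    by (subst measure_distr) (auto intro!: arg_cong[where f=prob])
  show ?thesis
    using *[OF measurable_UV[OF assms(1-3)]] *[OF measurable_UV[of 1 1 2]] distr_product[OF assms(1-4)] by simp
qed

lemma expectation_product:
  fixes h :: "real \<Rightarrow> real"
  assumes "k \<ge> 1" "i \<ge> 1" "j \<ge> 1" "i \<noteq> j" and h: "h \<in> borel_measurable borel"
  shows "expectation (\<lambda>\<omega>. h (U k i \<omega> * V k j \<omega>)) = expectation (\<lambda>\<omega>. h (U 1 1 \<omega> * V 1 2 \<omega>))"
proof -
  have *: "expectation (\<lambda>\<omega>. h (Y \<omega>)) = (\<integral>z. h z \<partial>distr M borel Y)" if "Y \<in> borel_measurable M" for Y :: "'a \<Rightarrow> real"
    using that h by (simp add: integrable_distr_eq integral_distr nn_integral_distr)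
  show ?thesis
    using *[OF measurable_UV[OF assms(1-3)]] *[OF measurable_UV[of 1 1 2]] distr_product[OF assms(1-4)] by simp
qed

lemma integrable_product:
  fixes h :: "real \<Rightarrow> real"
  assumes "k \<ge> 1" "i \<ge> 1" "j \<ge> 1" "i \<noteq> j" and h: "h \<in> borel_measurable borel"
  shows "integrable M (\<lambda>\<omega>. h (U k i \<omega> * V k j \<omega>)) \<longleftrightarrow> integrable M (\<lambda>\<omega>. h (U 1 1 \<omega> * V 1 2 \<omega>))"
proof -
  have *: "integrable M (\<lambda>\<omega>. h (Y \<omega>)) = integrable (distr M borel Y) h" if "Y \<in> borel_measurable M" for Y :: "'a \<Rightarrow> real"
    using that h by (simp add: integrable_distr_eq integral_distr nn_integral_distr)
  show ?thesis
    using *[OF measurable_UV[OF assms(1-3)]] *[OF measurable_UV[of 1 1 2]] distr_product[OF assms(1-4)] by simp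
qed

text \<open>Working with nonnegative integrals, the factorization also covers infinite second
  moments, with 0 times infinity equal to 0.\<close>

lemma nn_integral_factor:
  fixes f g :: "real \<Rightarrow> ennreal"
  assumes f: "f \<in> borel_measurable borel" and g: "g \<in> borel_measurable borel"
  shows "(\<integral>\<^sup>+\<omega>. f (U 1 1 \<omega>) * g (V 1 2 \<omega>) \<partial>M) = (\<integral>\<^sup>+\<omega>. f (U 1 1 \<omega>) \<partial>M) * (\<integral>\<^sup>+\<omega>. g (V 1 1 \<omega>) \<partial>M)"
proof -
  let ?I = "{(1, 1), (1, 2 :: nat)} :: (nat \<times> nat) set"
  define Y where "Y = (\<lambda>s :: nat \<times> nat. if snd s = 1 then f \<circ> fst else g \<circ> (snd :: real \<times> real \<Rightarrow> real))"
  have Y: "Y s \<in> borel_measurable borel" for s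
    using f g by (auto simp: Y_def intro: measurable_comp)
  have "indep_vars (\<lambda>_. borel) (\<lambda>s \<omega>. Y s (X s \<omega>)) ?I"
    by (rule indep_vars_compose2[OF indep_vars_subset[OF indep_X]]) (auto intro: Y)
  then have "(\<integral>\<^sup>+\<omega>. (\<Prod>s\<in>?I. Y s (X s \<omega>)) \<partial>M) = (\<Prod>s\<in>?I. \<integral>\<^sup>+\<omega>. Y s (X s \<omega>) \<partial>M)"
    by (intro indep_vars_nn_integral) auto
  moreover have "(\<integral>\<^sup>+\<omega>. g (V 1 2 \<omega>) \<partial>M) = (\<integral>\<^sup>+\<omega>. g (V 1 1 \<omega>) \<partial>M)"
  proof -
    have m: "(\<lambda>z :: real \<times> real. g (snd z)) \<in> borel_measurable borel"
      by (rule measurable_compose[OF borel_measurable_snd_real g])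
    have "(\<integral>\<^sup>+z. g (snd z) \<partial>distr M borel (X (1, 2))) = (\<integral>\<^sup>+z. g (snd z) \<partial>distr M borel (X (1, 1)))"
      using ident[of 1 2] by (simp add: X_def[abs_def])
    then show ?thesis
      using m by (simp add: nn_integral_distr[OF measurable_X]) (simp add: X_def)
  qed
  ultimately show ?thesis by (simp add: Y_def X_def)
qed

lemma expectation_factor:
  assumes "integrable M (U 1 1)" "integrable M (V 1 1)"
  shows "expectation (\<lambda>\<omega>. U 1 1 \<omega> * V 1 2 \<omega>) = expectation (U 1 1) * expectation (V 1 1)"
proof -
  let ?I = "{(1, 1), (1, 2 :: nat)} :: (nat \<times> nat) set"
  have V12: "integrable M (V 1 2) \<and> expectation (V 1 2) = expectation (V 1 1)"
  proof -
    have "distr M borel (X (1, 2)) = distr M borel (X (1, 1))"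
      using ident[of 1 2] by (simp add: X_def[abs_def])
    moreover have "integrable M (\<lambda>\<omega>. snd (X (1, i) \<omega>)) = integrable (distr M borel (X (1, i))) snd"
        "expectation (\<lambda>\<omega>. snd (X (1, i) \<omega>)) = (\<integral>z. snd z \<partial>distr M borel (X (1, i)))" if "i \<ge> 1" for i
      using measurable_X[of 1 i] that by (simp_all add: integrable_distr_eq integral_distr)
    from this[of 1] this[of 2] calculation show ?thesis using assms(2) by (simp add: X_def)
  qed
  define Y where "Y = (\<lambda>s :: nat \<times> nat. if snd s = 1 then fst else (snd :: real \<times> real \<Rightarrow> real))"
  have "indep_vars (\<lambda>_. borel) (\<lambda>s \<omega>. Y s (X s \<omega>)) ?I"
    by (rule indep_vars_compose2[OF indep_vars_subset[OF indep_X]]) (auto simp: Y_def)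
  then have "expectation (\<lambda>\<omega>. \<Prod>s\<in>?I. Y s (X s \<omega>)) = (\<Prod>s\<in>?I. expectation (\<lambda>\<omega>. Y s (X s \<omega>)))"
    by (intro indep_vars_lebesgue_integral) (use assms V12 in \<open>auto simp: Y_def X_def\<close>)
  then show ?thesis using V12 by (simp add: Y_def X_def)
qed

subsection \<open>Rescaling of the summability condition and tails\<close>

text \<open>Passing from \<open>n\<close> to \<open>n div K\<close> divides the threshold by about
  sqrt K, so for large \<open>K\<close> the constant \<open>C\<close> is beaten by
  \<open>\<epsilon>\<close>; the lost columns are regained by covering with blocks. This removes the
  unknown constant in part (b) and provides small thresholds in part (a).\<close>

lemma summable_rowmax_rescale:
  assumes sum: "summable (\<lambda>n. rowmax_prob (g n) (C * thr n))" and C: "C > 0"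
    and g: "\<And>m. m \<ge> m0 \<Longrightarrow> m \<le> B * g m" and "\<epsilon> > 0"
  shows "summable (\<lambda>n. rowmax_prob (A * n) (\<epsilon> * thr n))"
proof -
  obtain K :: nat where K: "K > 0" "C\<^sup>2 \<le> \<epsilon>\<^sup>2 * real K"
  proof -
    obtain K :: nat where "C\<^sup>2 / \<epsilon>\<^sup>2 \<le> real K" using real_arch_simple by blast
    then have "C\<^sup>2 / \<epsilon>\<^sup>2 \<le> real (Suc K)" by simp
    then have "C\<^sup>2 \<le> \<epsilon>\<^sup>2 * real (Suc K)" using \<open>\<epsilon> > 0\<close> by (simp add: field_simps del: of_nat_Suc)
    then show thesis using that[of "Suc K"] by auto
  qed
  \<comment> \<open>With \<open>m = n div K\<close>, the factors collect
    \<open>n \<le> 2 * K * m\<close> and \<open>m \<le> B * g m\<close>, so that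
    \<open>A * n \<le> J * g m\<close>.\<close>
  define J where "J = A * (2 * K * B)"
  have bound: "rowmax_prob (A * n) (\<epsilon> * thr n) \<le> (3 * real J)\<^sup>2 * rowmax_prob (g (n div K)) (C * thr (n div K))"
    if n: "n \<ge> K * (m0 + 2 * B + 2)" for n
  proof -
    define m where "m = n div K"
    have m: "m \<ge> m0 + 2 * B + 2" using n K by (simp add: m_def less_eq_div_iff_mult_less_eq mult.commute)
    have "n = m * K + n mod K" by (simp add: m_def)
    then have n1: "n \<le> 2 * K * m" "m * K \<le> n"
    proof -
      have "n mod K < K" using K by simp
      moreover have "K \<le> m * K" using m by simp
      moreover have "2 * K * m = m * K + m * K" by simp
      ultimately show "n \<le> 2 * K * m" using \<open>n = m * K + n mod K\<close> by linarith
    qed (simp add: m_def)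
    have gm: "m \<le> B * g m" using g m by simp
    \<comment> \<open>Two columns are needed to form a pair. This is secured by starting so late
      that \<open>m\<close> exceeds \<open>B\<close>.\<close>
    have "g m \<ge> 2"
    proof (rule ccontr)
      assume "\<not> g m \<ge> 2"
      then have "B * g m \<le> B * 1" by (intro mult_left_mono) auto
      then have "m \<le> B" using gm by linarith
      then show False using m by simp
    qed
    have thr: "C * thr m \<le> \<epsilon> * thr n"
    proof -
      have mn: "m \<le> n" using n1(2) K by (metis le_trans mult.commute mult_le_mono1 mult_1 Suc_leI One_nat_def)
      have "C\<^sup>2 * (real m * ln (real m)) \<le> (\<epsilon>\<^sup>2 * real K) * (real m * ln (real m))"
        using K m by (intro mult_right_mono) auto
      also have "\<dots> = \<epsilon>\<^sup>2 * (real (m * K) * ln (real m))" by (simp add: algebra_simps)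
      also have "\<dots> \<le> \<epsilon>\<^sup>2 * (real n * ln (real n))"
        using n1(2) mn m by (intro mult_left_mono mult_mono) (auto simp del: of_nat_mult)
      finally have "sqrt (C\<^sup>2 * (real m * ln (real m))) \<le> sqrt (\<epsilon>\<^sup>2 * (real n * ln (real n)))"
        by (rule real_sqrt_le_mono)
      then show ?thesis using C \<open>\<epsilon> > 0\<close> by (simp add: thr_def real_sqrt_mult)
    qed
    have "A * n \<le> A * (2 * K * m)" using n1(1) by (intro mult_left_mono) auto
    also have "\<dots> \<le> A * (2 * K * (B * g m))" using gm by (intro mult_left_mono) auto
    finally have "A * n \<le> J * g m" by (simp add: J_def algebra_simps)
    then have "rowmax_prob (A * n) (\<epsilon> * thr n) \<le> (3 * real J)\<^sup>2 * rowmax_prob (g m) (\<epsilon> * thr n)"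
      using \<open>g m \<ge> 2\<close> by (rule rowmax_prob_subadd)
    also have "\<dots> \<le> (3 * real J)\<^sup>2 * rowmax_prob (g m) (C * thr m)"
      using thr by (intro mult_left_mono rowmax_prob_mono) auto
    finally show ?thesis by (simp add: m_def)
  qed
  have "summable (\<lambda>n. (3 * real J)\<^sup>2 * rowmax_prob (g (n div K)) (C * thr (n div K)))"
    by (intro summable_mult summable_div[OF sum]) (use K in \<open>auto simp: rowmax_prob_nonneg\<close>)
  then show ?thesis
    by (rule summable_comparison_test'[where N = "K * (m0 + 2 * B + 2)"])
      (use bound in \<open>auto simp: rowmax_prob_nonneg\<close>)
qed

section \<open>The tail of a single product\<close>

definition tail :: "real \<Rightarrow> real" where
  "tail y = prob {\<omega> \<in> space M. y \<le> \<bar>U 1 1 \<omega> * V 1 2 \<omega>\<bar>}"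

lemma tail_nonneg: "0 \<le> tail y" and tail_le_1: "tail y \<le> 1"
  by (auto simp: tail_def)

lemma tail_antimono: "y \<le> z \<Longrightarrow> tail z \<le> tail y"
proof -
  have [measurable]: "(\<lambda>\<omega>. U 1 1 \<omega> * V 1 2 \<omega>) \<in> borel_measurable M" by (rule measurable_UV) auto
  show "y \<le> z \<Longrightarrow> tail z \<le> tail y"
    unfolding tail_def by (intro finite_measure_mono) (auto simp del: One_nat_def)
qed

text \<open>The columns 2 l + 1 and 2 l + 2 supply \<open>n div 2\<close> independent products, and
  (1 - q)^h <= exp(-h q).\<close>

lemma rowmax_prob_ge:
  "1 - exp (- (real (n div 2) * tail x)) \<le> rowmax_prob n x"
proof (cases "n div 2 = 0")
  case True
  then show ?thesis by (simp add: rowmax_prob_nonneg)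
next
  case False
  define h where "h = n div 2"
  define Y where "Y = (\<lambda>l \<omega>. U 1 (2 * l + 1) \<omega> * V 1 (2 * l + 2) \<omega>)"
  define E where "E = {z :: real. \<not> x \<le> \<bar>z\<bar>}"
  have [measurable]: "E \<in> sets borel" unfolding E_def by measurable
  have Ym[measurable]: "Y l \<in> borel_measurable M" for l unfolding Y_def by (rule measurable_UV) auto
  have "indep_vars (\<lambda>_. borel) Y UNIV" unfolding Y_def by (rule indep_products_columns)
  then have "prob (\<Inter>l\<in>{..<h}. Y l -` E \<inter> space M) = (\<Prod>l<h. prob (Y l -` E \<inter> space M))"
    by (rule indep_varsD) (use False in \<open>auto simp: h_def\<close>)
  also have "\<dots> = (\<Prod>l<h. 1 - tail x)"
  proof (intro prod.cong refl)
    fix l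
    have "Y l -` E \<inter> space M = space M - {\<omega> \<in> space M. x \<le> \<bar>Y l \<omega>\<bar>}" by (auto simp: E_def)
    then have "prob (Y l -` E \<inter> space M) = 1 - prob {\<omega> \<in> space M. x \<le> \<bar>Y l \<omega>\<bar>}"
      by (simp add: prob_compl)
    also have "prob {\<omega> \<in> space M. x \<le> \<bar>Y l \<omega>\<bar>} = tail x"
      unfolding Y_def tail_def by (rule prob_product) auto
    finally show "prob (Y l -` E \<inter> space M) = 1 - tail x" .
  qed
  also have "\<dots> = (1 - tail x) ^ h" by simp
  also have "\<dots> \<le> exp (- tail x) ^ h"
    using tail_le_1 exp_ge_add_one_self[of "- tail x"] by (intro power_mono) auto
  also have "\<dots> = exp (- (real h * tail x))" by (simp add: exp_of_nat_mult[symmetric])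
  finally have 1: "prob (\<Inter>l\<in>{..<h}. Y l -` E \<inter> space M) \<le> exp (- (real h * tail x))" .
  have "space M - rowmax_ev 1 {1..n} x \<subseteq> (\<Inter>l\<in>{..<h}. Y l -` E \<inter> space M)"
  proof (intro subsetI INT_I IntI vimageI2)
    fix \<omega> l assume \<omega>: "\<omega> \<in> space M - rowmax_ev 1 {1..n} x" and l: "l \<in> {..<h}"
    then have "2 * l + 1 \<in> {1..n}" "2 * l + 2 \<in> {1..n}" "2 * l + 1 \<noteq> 2 * l + 2" by (auto simp: h_def)
    then show "Y l \<omega> \<in> E" using \<omega> unfolding rowmax_ev_def Y_def E_def by blast
  qed auto
  then have "prob (space M - rowmax_ev 1 {1..n} x) \<le> prob (\<Inter>l\<in>{..<h}. Y l -` E \<inter> space M)"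
    using False by (intro finite_measure_mono sets.finite_INT) (auto simp: h_def)
  then have "1 - rowmax_prob n x \<le> prob (\<Inter>l\<in>{..<h}. Y l -` E \<inter> space M)"
    unfolding rowmax_prob_def by (subst (asm) prob_compl) (auto intro!: rowmax_ev_sets)
  with 1 show ?thesis by (simp add: h_def)
qed

text \<open>The lower bound on row maxima makes the series of n \<open>tail (thr n)\<close>
  converge. As \<open>tail (thr n)\<close> decreases, each of the n/2 terms just below n is at least
  of order n \<open>tail (thr n)\<close>; hence n^2 \<open>tail (thr n)\<close> stays
  bounded.\<close>

lemma tail_bound_thr:
  assumes sum: "summable (\<lambda>n. rowmax_prob n (thr n))"
  obtains C where "C \<ge> 0" "\<And>n. n \<ge> 1 \<Longrightarrow> tail (thr n) \<le> C / (real n)\<^sup>2"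
proof -
  let ?S = "suminf (\<lambda>n. rowmax_prob n (thr n))"
  have "(\<lambda>n. rowmax_prob n (thr n)) \<longlonglongrightarrow> 0" by (rule summable_LIMSEQ_zero[OF sum])
  then have "\<forall>\<^sub>F n in sequentially. rowmax_prob n (thr n) < 1/2" by (rule order_tendstoD) auto
  then obtain N0 where N0: "\<And>n. n \<ge> N0 \<Longrightarrow> rowmax_prob n (thr n) < 1/2"
    by (auto simp: eventually_sequentially)
  have key: "real (n div 2) * tail (thr n) \<le> 2 * rowmax_prob n (thr n)" if "n \<ge> N0" for n
  proof -
    define y where "y = real (n div 2) * tail (thr n)"
    define r where "r = rowmax_prob n (thr n)"
    have y: "y \<ge> 0" by (simp add: y_def tail_nonneg)
    \<comment> \<open>For small \<open>r\<close>, the bound 1 - exp(-y) <= r is nearly y <= r.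
      Replacing the exponential by 1 / (1 + y) and using r < 1/2 turns it into y <= 2 r.\<close>
    have "exp (- y) \<le> 1 / (1 + y)"
      using y exp_ge_add_one_self[of y] by (simp add: exp_minus field_simps)
    moreover have "1 - exp (- y) \<le> r" unfolding y_def r_def by (rule rowmax_prob_ge)
    ultimately have "1 - r \<le> 1 / (1 + y)" by linarith
    then have "(1 - r) * (1 + y) \<le> 1" using y by (simp add: field_simps)
    moreover have "(1/2) * y \<le> (1 - r) * y" using N0[OF that] y by (intro mult_right_mono) (auto simp: r_def)
    ultimately have "y \<le> 2 * r" by (simp add: algebra_simps)
    then show ?thesis by (simp add: y_def r_def)
  qed
  define N1 where "N1 = 2 * N0 + 8"
  have large: "tail (thr n) \<le> (64 * ?S) / (real n)\<^sup>2" if n: "n \<ge> N1" for n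
  proof -
    let ?I = "{n - n div 2..<n}"
    have "real (n div 2) * (real n / 8 * tail (thr n)) = (\<Sum>m\<in>?I. real n / 8 * tail (thr n))"
      by simp
    also have "\<dots> \<le> (\<Sum>m\<in>?I. 2 * rowmax_prob m (thr m))"
    proof (rule sum_mono)
      fix m assume m: "m \<in> ?I"
      have "n \<le> 8 * (m div 2)" using m n unfolding N1_def by auto
      then have "real n / 8 \<le> real (m div 2)" by linarith
      then have "real n / 8 * tail (thr n) \<le> real (m div 2) * tail (thr m)"
        using m by (intro mult_mono tail_antimono thr_mono) (auto simp: tail_nonneg)
      also have "\<dots> \<le> 2 * rowmax_prob m (thr m)" by (rule key) (use m n in \<open>auto simp: N1_def\<close>)
      finally show "real n / 8 * tail (thr n) \<le> 2 * rowmax_prob m (thr m)" .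
    qed
    also have "\<dots> = 2 * (\<Sum>m\<in>?I. rowmax_prob m (thr m))" by (simp add: sum_distrib_left)
    also have "\<dots> \<le> 2 * ?S"
      using sum by (intro mult_left_mono sum_le_suminf) (auto simp: rowmax_prob_nonneg)
    finally have "real (n div 2) * (real n / 8 * tail (thr n)) \<le> 2 * ?S" .
    moreover have "real n / 4 * (real n / 8 * tail (thr n)) \<le> real (n div 2) * (real n / 8 * tail (thr n))"
    proof (rule mult_right_mono)
      have "n \<le> 4 * (n div 2)" using n unfolding N1_def by auto
      then show "real n / 4 \<le> real (n div 2)" by linarith
    qed (simp add: tail_nonneg)
    ultimately have "(real n)\<^sup>2 * tail (thr n) \<le> 64 * ?S" by (simp add: power2_eq_square)
    moreover have "n > 0" using n by (simp add: N1_def)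
    ultimately show ?thesis by (simp add: field_simps)
  qed
  \<comment> \<open>The second entry covers the finitely many n below \<open>N1\<close>, where the
    tail is only bounded by 1.\<close>
  define C where "C = max (64 * ?S) ((real N1)\<^sup>2)"
  show thesis
  proof (rule that[of C])
    show "C \<ge> 0" by (simp add: C_def le_max_iff_disj)
    fix n :: nat assume n: "n \<ge> 1"
    show "tail (thr n) \<le> C / (real n)\<^sup>2"
    proof (cases "n \<ge> N1")
      case True
      have "tail (thr n) \<le> (64 * ?S) / (real n)\<^sup>2" by (rule large[OF True])
      also have "\<dots> \<le> C / (real n)\<^sup>2" by (intro divide_right_mono) (auto simp: C_def)
      finally show ?thesis .
    next
      case False
      have "tail (thr n) * (real n)\<^sup>2 \<le> 1 * (real N1)\<^sup>2"
        using False by (intro mult_mono tail_le_1 power_mono) auto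
      also have "\<dots> \<le> C" by (simp add: C_def)
      finally show ?thesis using n by (simp add: field_simps)
    qed
  qed
qed

text \<open>At \<open>thr n\<close> the tail is of order n^(-2), and \<open>thr n\<close> <=
  n^(3/4), so a given y is compared with n near y^(4/3). The resulting power is weaker than the
  y^(-4) log^2 y hidden in the previous bound, but steeper than y^(-2), as square integrability
  requires.\<close>

lemma tail_bound:
  assumes sum: "summable (\<lambda>n. rowmax_prob n (thr n))"
  obtains C where "C \<ge> 0" "\<And>y. y \<ge> 1 \<Longrightarrow> tail y \<le> C * y powr (-8/3)"
proof -
  obtain C where C: "C \<ge> 0" "\<And>n. n \<ge> 1 \<Longrightarrow> tail (thr n) \<le> C / (real n)\<^sup>2"
    using tail_bound_thr[OF sum] by blast
  have "tail y \<le> (4 * C) * y powr (-8/3)" if y: "y \<ge> 1" for y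
  proof -
    define x where "x = y powr (4/3)"
    have x: "x \<ge> 1" using y by (simp add: x_def ge_one_powr_ge_zero)
    define n where "n = nat \<lfloor>x\<rfloor>"
    have "\<lfloor>x\<rfloor> \<ge> 1" using x by (simp add: le_floor_iff)
    moreover have "real_of_int \<lfloor>x\<rfloor> \<le> x" "x < real_of_int \<lfloor>x\<rfloor> + 1" by linarith+
    moreover have "real n = real_of_int \<lfloor>x\<rfloor>" using \<open>\<lfloor>x\<rfloor> \<ge> 1\<close> by (simp add: n_def)
    ultimately have n: "n \<ge> 1" "real n \<le> x" "x \<le> 2 * real n" by linarith+
    have "thr n \<le> y"
    proof -
      have "real n * ln (real n) \<le> real n * sqrt (real n)"
        using n ln_le_sqrt[of "real n"] by (intro mult_left_mono) auto
      also have "\<dots> \<le> x * sqrt x" using n by (intro mult_mono) auto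
      also have "\<dots> = y\<^sup>2"
        using y by (simp add: x_def powr_half_sqrt[symmetric] powr_powr powr_add[symmetric] flip: powr_numeral)
      finally show ?thesis using y by (simp add: thr_def real_le_lsqrt)
    qed
    then have "tail y \<le> tail (thr n)" by (rule tail_antimono)
    also have "\<dots> \<le> C / (real n)\<^sup>2" by (rule C(2)[OF n(1)])
    also have "\<dots> \<le> C / (x / 2)\<^sup>2"
      using n x C(1) by (intro divide_left_mono power_mono mult_pos_pos) auto
    also have "\<dots> = (4 * C) * x powr (-2)" using x by (simp add: powr_minus_divide power_divide)
    also have "x powr (-2) = y powr (-8/3)" by (simp add: x_def powr_powr)
    finally show ?thesis .
  qed
  then show thesis using C(1) by (intro that[of "4 * C"]) auto
qed

text \<open>For \<open>n < 2\<close> the identity fails: the threshold is 0, which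
  \<open>Mstat\<close> always reaches, while fewer than two columns contain no pair. Summability
  ignores these two terms.\<close>

lemma prob_Mstat_ge:
  "n \<ge> 2 \<Longrightarrow> measure M {\<omega> \<in> space M. Mstat U V n \<omega> \<ge> thr n} = rowmax_prob n (thr n)"
  by (simp only: rowmax_prob_def rowmax_ev_def le_Mstat_iff[OF thr_pos])

lemma summable_Mstat_iff:
  "summable (\<lambda>n. measure M {\<omega> \<in> space M. Mstat U V n \<omega> \<ge> thr n}) \<longleftrightarrow>
    summable (\<lambda>n. rowmax_prob n (thr n))"
  by (intro summable_cong eventually_sequentiallyI[of 2] prob_Mstat_ge)

subsection \<open>Necessity\<close>

text \<open>The square of a product is at most the number of m >= 0 whose root does not exceed its
  absolute value. The expected count is the series of \<open>tail (sqrt (real m))\<close>, of order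
  m^(-4/3).\<close>

lemma nn_integral_square_finite:
  assumes C: "C \<ge> 0" "\<And>y. y \<ge> 1 \<Longrightarrow> tail y \<le> C * y powr (-8/3)"
  shows "(\<integral>\<^sup>+\<omega>. ennreal ((U 1 1 \<omega> * V 1 2 \<omega>)\<^sup>2) \<partial>M) < \<infinity>"
proof -
  define Z where "Z = (\<lambda>\<omega>. U 1 1 \<omega> * V 1 2 \<omega>)"
  have [measurable]: "Z \<in> borel_measurable M" unfolding Z_def by (rule measurable_UV) auto
  have ev: "emeasure M {\<omega> \<in> space M. sqrt (real m) \<le> \<bar>Z \<omega>\<bar>} = ennreal (tail (sqrt (real m)))" for m
    by (simp only: tail_def Z_def emeasure_eq_measure)
  have pt: "ennreal ((Z \<omega>)\<^sup>2) \<le> (\<Sum>m. indicator {\<omega> \<in> space M. sqrt (real m) \<le> \<bar>Z \<omega>\<bar>} \<omega>)"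
    if \<omega>: "\<omega> \<in> space M" for \<omega>
  proof -
    define K where "K = nat \<lfloor>(Z \<omega>)\<^sup>2\<rfloor> + 1"
    have ind: "indicator {\<omega> \<in> space M. sqrt (real m) \<le> \<bar>Z \<omega>\<bar>} \<omega> = (1 :: ennreal)" if "m < K" for m
    proof -
      have "m \<le> nat \<lfloor>(Z \<omega>)\<^sup>2\<rfloor>" using that by (simp add: K_def)
      then have "real m \<le> (Z \<omega>)\<^sup>2" by (simp add: le_nat_iff le_floor_iff)
      then have "sqrt (real m) \<le> \<bar>Z \<omega>\<bar>" using real_sqrt_le_mono by fastforce
      then show ?thesis using \<omega> by simp
    qed
    have "(Z \<omega>)\<^sup>2 \<le> real K" unfolding K_def by (simp; linarith)
    then have "ennreal ((Z \<omega>)\<^sup>2) \<le> ennreal (real K)" by (rule ennreal_leI)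
    also have "\<dots> = (\<Sum>m<K. indicator {\<omega> \<in> space M. sqrt (real m) \<le> \<bar>Z \<omega>\<bar>} \<omega>)"
      by (simp add: ind ennreal_of_nat_eq_real_of_nat)
    also have "\<dots> \<le> (\<Sum>m. indicator {\<omega> \<in> space M. sqrt (real m) \<le> \<bar>Z \<omega>\<bar>} \<omega>)"
      by (intro sum_le_suminf) auto
    finally show ?thesis .
  qed
  have "(\<integral>\<^sup>+\<omega>. ennreal ((Z \<omega>)\<^sup>2) \<partial>M)
      \<le> (\<integral>\<^sup>+\<omega>. (\<Sum>m. indicator {\<omega> \<in> space M. sqrt (real m) \<le> \<bar>Z \<omega>\<bar>} \<omega>) \<partial>M)"
    by (intro nn_integral_mono pt)
  also have "\<dots> = (\<Sum>m. ennreal (tail (sqrt (real m))))"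
    by (subst nn_integral_suminf) (auto simp: ev)
  also have "\<dots> < \<infinity>"
  proof -
    have "summable (\<lambda>m. tail (sqrt (real m)))"
    proof (rule summable_comparison_test'[where N = 1])
      show "summable (\<lambda>m. C * real m powr (-4/3))"
        by (intro summable_mult) (simp add: summable_real_powr_iff)
      fix m :: nat assume m: "m \<ge> 1"
      have "tail (sqrt (real m)) \<le> C * sqrt (real m) powr (-8/3)" using m by (intro C) auto
      also have "sqrt (real m) powr (-8/3) = real m powr (-4/3)"
        using m by (simp add: powr_half_sqrt[symmetric] powr_powr)
      finally show "norm (tail (sqrt (real m))) \<le> C * real m powr (-4/3)" by (simp add: tail_nonneg)
    qed
    then have "(\<Sum>m. ennreal (tail (sqrt (real m)))) \<noteq> top"
      by (rule ennreal_suminf_neq_top) (rule tail_nonneg)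
    then show ?thesis by (simp only: less_top infinity_ennreal_def)
  qed
  finally show ?thesis by (simp add: Z_def)
qed

text \<open>The bound \<open>N\<close> depends on the sample point, so no fixed threshold is given
  in advance. But there are countably many candidates, so some \<open>G N\<close> has positive
  probability. Independence of the rows bounds that probability by the product of the 1 -
  \<open>r n\<close>, hence by exp of minus each partial sum, and the partial sums stay below minus
  the logarithm of \<open>prob (G N)\<close>.\<close>

lemma summable_of_AE_no_rowmax:
  assumes AE: "AE \<omega> in M. \<exists>N. \<forall>n\<ge>N. \<omega> \<notin> rowmax_ev n {1..g n} (real N * thr n)"
  shows "\<exists>C>0. summable (\<lambda>n. rowmax_prob (g n) (C * thr n))"
proof -
  \<comment> \<open>Taking \<open>Suc N\<close> in place of \<open>N\<close> keeps the rows at least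
    1 and makes the constant positive.\<close>
  define G where "G = (\<lambda>N. \<Inter>n\<in>{Suc N..}. space M - rowmax_ev n {1..g n} (real (Suc N) * thr n))"
  have ev: "rowmax_ev n {1..g n} x \<in> sets M" if "n \<ge> 1" for n x
    using that by (intro rowmax_ev_sets) auto
  have G: "G N \<in> sets M" for N
    unfolding G_def by (intro sets.countable_INT' sets.compl_sets image_subsetI ev) auto
  have AEG: "AE \<omega> in M. \<exists>N. \<omega> \<in> G N"
    using AE AE_space
  proof eventually_elim
    case (elim \<omega>)
    then obtain N where N: "\<And>n. n \<ge> N \<Longrightarrow> \<omega> \<notin> rowmax_ev n {1..g n} (real N * thr n)" by blast
    have "\<omega> \<notin> rowmax_ev n {1..g n} (real (Suc N) * thr n)" if "n \<ge> Suc N" for n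
    proof -
      have "real N * thr n \<le> real (Suc N) * thr n" using thr_nonneg by (intro mult_right_mono) auto
      then have "rowmax_ev n {1..g n} (real (Suc N) * thr n) \<subseteq> rowmax_ev n {1..g n} (real N * thr n)"
        unfolding rowmax_ev_def by (force intro: order_trans)
      then show ?thesis using N[of n] that by auto
    qed
    then have "\<omega> \<in> G N" using elim by (auto simp: G_def)
    then show ?case ..
  qed
  obtain N where N: "prob (G N) > 0"
  proof (rule ccontr)
    assume "\<not> thesis"
    with that have "prob (G N) = 0" for N using measure_nonneg[of M "G N"] by (metis order_le_less)
    then have "AE \<omega> in M. \<omega> \<notin> G N" for N using G by (simp add: prob_eq_0)
    then have "AE \<omega> in M. \<forall>N. \<omega> \<notin> G N" by (simp add: AE_all_countable)
    with AEG have "AE \<omega> in M. False" by eventually_elim auto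
    then show False by simp
  qed
  define C where "C = real (Suc N)"
  define r where "r = (\<lambda>n. rowmax_prob (g n) (C * thr n))"
  have r: "prob (rowmax_ev n {1..g n} (C * thr n)) = r n" if "n \<ge> 1" for n
    using that by (subst prob_rowmax_ev_card) (auto simp: r_def)
  have bound: "(\<Sum>n<m. r (n + Suc N)) \<le> - ln (prob (G N))" for m
  proof (cases "m = 0")
    case False
    let ?L = "{Suc N..<m + Suc N}"
    have "prob (G N) \<le> prob (\<Inter>n\<in>?L. space M - rowmax_ev n {1..g n} (C * thr n))"
      using False
      by (intro finite_measure_mono sets.finite_INT sets.compl_sets ev) (auto simp: G_def C_def)
    also have "\<dots> = (\<Prod>n\<in>?L. 1 - prob (rowmax_ev n {1..g n} (C * thr n)))"
      using False by (intro prob_no_rowmax) auto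
    also have "\<dots> = (\<Prod>n\<in>?L. 1 - r n)" by (intro prod.cong refl arg_cong2[where f = minus] r) auto
    also have "\<dots> \<le> (\<Prod>n\<in>?L. exp (- r n))"
    proof (intro prod_mono conjI)
      fix n assume "n \<in> ?L"
      show "0 \<le> 1 - r n" by (simp add: r_def rowmax_prob_def)
      show "1 - r n \<le> exp (- r n)" using exp_ge_add_one_self[of "- r n"] by simp
    qed
    also have "\<dots> = exp (- (\<Sum>n\<in>?L. r n))" by (simp only: exp_sum[OF finite_atLeastLessThan, symmetric] sum_negf)
    finally have "ln (prob (G N)) \<le> ln (exp (- (\<Sum>n\<in>?L. r n)))" using N by (intro ln_mono) auto
    then have "ln (prob (G N)) \<le> - (\<Sum>n\<in>?L. r n)" by simp
    moreover have "(\<Sum>n<m. r (n + Suc N)) = (\<Sum>n\<in>?L. r n)"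
      using sum.shift_bounds_nat_ivl[of r 0 "Suc N" m] by (simp add: lessThan_atLeast0)
    ultimately show ?thesis by simp
  qed (use N in auto)
  have "summable (\<lambda>n. r (n + Suc N))"
    by (rule summableI_nonneg_bounded[OF _ bound]) (simp add: r_def rowmax_prob_nonneg)
  then have "summable r" by (subst (asm) summable_iff_shift)
  then show ?thesis unfolding r_def by (intro exI[of _ C]) (simp add: C_def)
qed

text \<open>The cross terms vanish, since the rows are independent and centred. The nonnegative
  integral is the form that Fatou's lemma takes up.\<close>

lemma second_moment_sum:
  assumes sq: "integrable M (\<lambda>\<omega>. (U 1 1 \<omega> * V 1 2 \<omega>)\<^sup>2)"
  defines "\<mu> \<equiv> expectation (\<lambda>\<omega>. U 1 1 \<omega> * V 1 2 \<omega>)"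
  shows "(\<integral>\<^sup>+\<omega>. ennreal ((\<Sum>k=1..n. U k 1 \<omega> * V k 2 \<omega> - \<mu>)\<^sup>2) \<partial>M)
    = ennreal (real n * expectation (\<lambda>\<omega>. (U 1 1 \<omega> * V 1 2 \<omega> - \<mu>)\<^sup>2))"
proof -
  define Y where "Y = (\<lambda>k \<omega>. U k 1 \<omega> * V k 2 \<omega> - \<mu>)"
  define s where "s = expectation (\<lambda>\<omega>. (U 1 1 \<omega> * V 1 2 \<omega> - \<mu>)\<^sup>2)"
  have Z: "(\<lambda>\<omega>. U 1 1 \<omega> * V 1 2 \<omega>) \<in> borel_measurable M" by (rule measurable_UV) auto
  have int1: "integrable M (\<lambda>\<omega>. U 1 1 \<omega> * V 1 2 \<omega>)" by (rule square_integrable_imp_integrable[OF Z sq])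
  have intZ: "integrable M (\<lambda>\<omega>. U 1 1 \<omega> * V 1 2 \<omega> - \<mu>)" using int1 by simp
  have intZ2: "integrable M (\<lambda>\<omega>. (U 1 1 \<omega> * V 1 2 \<omega> - \<mu>)\<^sup>2)"
    using sq int1 by (simp add: power2_diff)
  have intY: "integrable M (Y k)" "expectation (Y k) = 0" if "k \<ge> 1" for k
  proof -
    show "integrable M (Y k)" unfolding Y_def
      using integrable_product[of k 1 2 "\<lambda>z. z - \<mu>"] that intZ by simp
    have "expectation (Y k) = expectation (\<lambda>\<omega>. U 1 1 \<omega> * V 1 2 \<omega> - \<mu>)"
      unfolding Y_def using that by (intro expectation_product[where h = "\<lambda>z. z - \<mu>"]) auto
    also have "\<dots> = 0" using int1 by (simp add: \<mu>_def prob_space)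
    finally show "expectation (Y k) = 0" .
  qed
  have intY2: "integrable M (\<lambda>\<omega>. (Y k \<omega>)\<^sup>2)" "expectation (\<lambda>\<omega>. (Y k \<omega>)\<^sup>2) = s" if "k \<ge> 1" for k
    unfolding Y_def s_def
    using integrable_product[of k 1 2 "\<lambda>z. (z - \<mu>)\<^sup>2"] expectation_product[of k 1 2 "\<lambda>z. (z - \<mu>)\<^sup>2"] that intZ2
    by simp_all
  have "indep_vars (\<lambda>_. borel) Y {1..}"
    unfolding Y_def using indep_products_rows[of 1 2]
    by (rule indep_vars_compose2[where Y = "\<lambda>_ z. z - \<mu>"]) auto
  then have cross: "integrable M (\<lambda>\<omega>. Y k \<omega> * Y l \<omega>)" "expectation (\<lambda>\<omega>. Y k \<omega> * Y l \<omega>) = 0"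
    if "k \<ge> 1" "l \<ge> 1" "k \<noteq> l" for k l
  proof -
    have "indep_vars (\<lambda>_. borel) Y {k, l}"
      by (rule indep_vars_subset) (fact, use that in auto)
    then have "expectation (\<lambda>\<omega>. \<Prod>i\<in>{k, l}. Y i \<omega>) = (\<Prod>i\<in>{k, l}. expectation (Y i))"
        "integrable M (\<lambda>\<omega>. \<Prod>i\<in>{k, l}. Y i \<omega>)"
      using that by (auto intro!: indep_vars_lebesgue_integral indep_vars_integrable simp del: prod.insert intro: intY)
    then show "integrable M (\<lambda>\<omega>. Y k \<omega> * Y l \<omega>)" "expectation (\<lambda>\<omega>. Y k \<omega> * Y l \<omega>) = 0"
      using that by (simp_all add: intY)
  qed
  have prodY: "integrable M (\<lambda>\<omega>. Y k \<omega> * Y l \<omega>)" "expectation (\<lambda>\<omega>. Y k \<omega> * Y l \<omega>) = (if k = l then s else 0)"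
    if "k \<ge> 1" "l \<ge> 1" for k l
    using cross[of k l] intY2[of k] that by (auto simp: power2_eq_square)
  have eq: "(\<Sum>k=1..n. Y k \<omega>)\<^sup>2 = (\<Sum>k=1..n. \<Sum>l=1..n. Y k \<omega> * Y l \<omega>)" for \<omega>
    by (simp add: power2_eq_square sum_product)
  have int: "integrable M (\<lambda>\<omega>. (\<Sum>k=1..n. Y k \<omega>)\<^sup>2)"
    unfolding eq by (intro Bochner_Integration.integrable_sum prodY) auto
  have "expectation (\<lambda>\<omega>. (\<Sum>k=1..n. Y k \<omega>)\<^sup>2) = (\<Sum>k=1..n. expectation (\<lambda>\<omega>. \<Sum>l=1..n. Y k \<omega> * Y l \<omega>))"
    unfolding eq by (rule Bochner_Integration.integral_sum) (rule Bochner_Integration.integrable_sum, rule prodY, auto)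
  also have "\<dots> = (\<Sum>k=1..n. \<Sum>l=1..n. expectation (\<lambda>\<omega>. Y k \<omega> * Y l \<omega>))"
    by (rule sum.cong[OF refl], rule Bochner_Integration.integral_sum, rule prodY) auto
  also have "\<dots> = (\<Sum>k=1..n. \<Sum>l=1..n. if k = l then s else 0)"
    by (intro sum.cong refl prodY) auto
  also have "\<dots> = real n * s" by (simp add: sum.delta)
  finally show ?thesis
    using nn_integral_eq_integral[OF int] unfolding Y_def s_def by simp
qed

lemma mean_zero:
  assumes sq: "integrable M (\<lambda>\<omega>. (U 1 1 \<omega> * V 1 2 \<omega>)\<^sup>2)"
    and AE: "AE \<omega> in M. \<exists>N. \<forall>n\<ge>N. \<bar>\<Sum>k=1..n. U k 1 \<omega> * V k 2 \<omega>\<bar> \<le> real N * thr n"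
  shows "expectation (\<lambda>\<omega>. U 1 1 \<omega> * V 1 2 \<omega>) = 0"
proof -
  define \<mu> where "\<mu> = expectation (\<lambda>\<omega>. U 1 1 \<omega> * V 1 2 \<omega>)"
  define s where "s = expectation (\<lambda>\<omega>. (U 1 1 \<omega> * V 1 2 \<omega> - \<mu>)\<^sup>2)"
  define S where "S = (\<lambda>n \<omega>. \<Sum>k=1..n. U k 1 \<omega> * V k 2 \<omega> - \<mu>)"
  have m[measurable]: "S n \<in> borel_measurable M" for n
    unfolding S_def by (intro borel_measurable_sum borel_measurable_diff measurable_UV) auto
  have s: "s \<ge> 0" by (simp add: s_def)
  have mom: "(\<integral>\<^sup>+\<omega>. ennreal ((S n \<omega> / real n)\<^sup>2) \<partial>M) = ennreal (s / real n)" if "n \<ge> 1" for n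
  proof -
    have "(\<integral>\<^sup>+\<omega>. ennreal ((S n \<omega> / real n)\<^sup>2) \<partial>M) = (\<integral>\<^sup>+\<omega>. ennreal (1 / (real n)\<^sup>2) * ennreal ((S n \<omega>)\<^sup>2) \<partial>M)"
      by (intro nn_integral_cong) (simp add: power_divide ennreal_mult'[symmetric])
    also have "\<dots> = ennreal (1 / (real n)\<^sup>2) * (\<integral>\<^sup>+\<omega>. ennreal ((S n \<omega>)\<^sup>2) \<partial>M)"
      by (rule nn_integral_cmult) measurable
    also have "\<dots> = ennreal (1 / (real n)\<^sup>2) * ennreal (real n * s)"
      unfolding S_def \<mu>_def s_def by (subst second_moment_sum[OF sq]) simp
    also have "\<dots> = ennreal (s / real n)"
      using that s by (simp add: ennreal_mult'[symmetric] power2_eq_square)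
    finally show ?thesis .
  qed
  have "AE \<omega> in M. liminf (\<lambda>n. ennreal ((S n \<omega> / real n)\<^sup>2)) = ennreal (\<mu>\<^sup>2)"
    using AE
  proof eventually_elim
    case (elim \<omega>)
    then obtain N where N: "\<And>n. n \<ge> N \<Longrightarrow> \<bar>\<Sum>k=1..n. U k 1 \<omega> * V k 2 \<omega>\<bar> \<le> real N * thr n" by blast
    define T where "T = (\<lambda>n. \<Sum>k=1..n. U k 1 \<omega> * V k 2 \<omega>)"
    have "(\<lambda>n. T n / real n) \<longlonglongrightarrow> 0"
    proof (rule Lim_null_comparison)
      show "\<forall>\<^sub>F n in sequentially. norm (T n / real n) \<le> real N * thr n / real n"
        using N by (intro eventually_sequentiallyI[of N]) (auto simp: T_def intro!: divide_right_mono)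
    qed (rule thr_div_tendsto_0)
    then have "(\<lambda>n. T n / real n - \<mu>) \<longlonglongrightarrow> 0 - \<mu>" by (intro tendsto_intros)
    moreover have "\<forall>\<^sub>F n in sequentially. T n / real n - \<mu> = S n \<omega> / real n"
      by (intro eventually_sequentiallyI[of 1]) (simp add: S_def T_def sum_subtractf field_simps)
    ultimately have "(\<lambda>n. S n \<omega> / real n) \<longlonglongrightarrow> - \<mu>" by (simp add: tendsto_cong)
    then have "(\<lambda>n. ennreal ((S n \<omega> / real n)\<^sup>2)) \<longlonglongrightarrow> ennreal ((- \<mu>)\<^sup>2)"
      by (intro tendsto_ennrealI tendsto_power)
    from lim_imp_Liminf[OF _ this] show ?case by simp
  qed
  then have "(\<integral>\<^sup>+\<omega>. ennreal (\<mu>\<^sup>2) \<partial>M) = (\<integral>\<^sup>+\<omega>. liminf (\<lambda>n. ennreal ((S n \<omega> / real n)\<^sup>2)) \<partial>M)"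
    by (intro nn_integral_cong_AE) (auto elim: eventually_mono)
  also have "\<dots> \<le> liminf (\<lambda>n. \<integral>\<^sup>+\<omega>. ennreal ((S n \<omega> / real n)\<^sup>2) \<partial>M)"
    by (rule nn_integral_liminf) measurable
  also have "\<dots> = 0"
  proof -
    have "(\<lambda>n. ennreal (s / real n)) \<longlonglongrightarrow> ennreal 0"
      by (intro tendsto_ennrealI lim_const_over_n)
    moreover have "\<forall>\<^sub>F n in sequentially. (\<integral>\<^sup>+\<omega>. ennreal ((S n \<omega> / real n)\<^sup>2) \<partial>M) = ennreal (s / real n)"
      using mom by (intro eventually_sequentiallyI[of 1]) auto
    ultimately have "(\<lambda>n. \<integral>\<^sup>+\<omega>. ennreal ((S n \<omega> / real n)\<^sup>2) \<partial>M) \<longlonglongrightarrow> ennreal 0"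
      by (simp only: tendsto_cong)
    from lim_imp_Liminf[OF _ this] show ?thesis by simp
  qed
  finally have "ennreal (\<mu>\<^sup>2) = 0" by (simp add: emeasure_space_1)
  then show ?thesis by (simp add: \<mu>_def)
qed

lemma limsup_finite_imp:
  assumes pbd: "0 < a" "\<And>n. n \<ge> 1 \<Longrightarrow> a \<le> real n / real (p n) \<and> real n / real (p n) \<le> b"
    and AE: "AE \<omega> in M. limsup (\<lambda>n. ereal (Tstat U V p n \<omega> / thr n)) < \<infinity>"
  shows "summable (\<lambda>n. rowmax_prob n (thr n))"
    and "(\<integral>\<^sup>+\<omega>. ennreal ((U 1 1 \<omega> * V 1 2 \<omega>)\<^sup>2) \<partial>M) < \<infinity>"
    and "expectation (\<lambda>\<omega>. U 1 1 \<omega> * V 1 2 \<omega>) = 0"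
proof -
  have p: "real n \<le> b * real (p n)" "p n > 0" if "n \<ge> 1" for n
  proof -
    \<comment> \<open>If \<open>p n\<close> were 0, the quotient would be 0 by convention and so
      fall below \<open>a\<close>.\<close>
    show "p n > 0" using pbd(1) pbd(2)[OF that] by (cases "p n = 0") auto
    then show "real n \<le> b * real (p n)" using pbd(2)[OF that] by (simp add: field_simps)
  qed
  have "b > 0" using pbd(1) pbd(2)[of 1] by linarith
  \<comment> \<open>The factor 2 absorbs n <= 2 (n - 1). The first \<open>n div B\<close> columns
    must be present at time \<open>n\<close> and at time \<open>n - 1\<close>, because the last
    product is the difference of two consecutive sums and \<open>p\<close> may fail to be
    monotone.\<close>
  obtain B :: nat where B: "2 * b \<le> real B" using real_arch_simple by blast
  then have "B > 0" using \<open>b > 0\<close> by (cases "B = 0") auto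
  have cols: "n div B \<le> p n \<and> n div B \<le> p (n - 1)" if n: "n \<ge> 2" for n
  proof -
    have "real (n div B) * (2 * b) \<le> real (n div B) * real B" using B by (intro mult_left_mono) auto
    also have "\<dots> \<le> real n" by (simp flip: of_nat_mult)
    finally have 1: "b * (2 * real (n div B)) \<le> real n" by (simp add: algebra_simps)
    have le: "real n \<le> 2 * real (n - 1)" using n by linarith
    have "real (n - 1) \<le> b * real (p (n - 1))" by (rule p(1)) (use n in auto)
    with 1 le have "b * (2 * real (n div B)) \<le> b * (2 * real (p (n - 1)))" by linarith
    moreover have "b * (2 * real (n div B)) \<le> b * (2 * real (p n))"
    proof -
      have "real n \<le> b * real (p n)" by (rule p(1)) (use n in auto)
      also have "\<dots> \<le> b * (2 * real (p n))" using \<open>b > 0\<close> by simp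
      finally show ?thesis using 1 by linarith
    qed
    ultimately show ?thesis using \<open>b > 0\<close> by simp
  qed
  have bdd: "AE \<omega> in M. \<exists>N. \<forall>n\<ge>N. Tstat U V p n \<omega> \<le> real N * thr n"
    using AE
  proof eventually_elim
    case (elim \<omega>)
    from limsup_less_infinityE[OF this] show ?case by blast
  qed
  have "AE \<omega> in M. \<exists>N. \<forall>n\<ge>N. \<omega> \<notin> rowmax_ev n {1..n div B} (real N * thr n)"
    using bdd
  proof eventually_elim
    case (elim \<omega>)
    then obtain N where N: "\<And>n. n \<ge> N \<Longrightarrow> Tstat U V p n \<omega> \<le> real N * thr n" by blast
    \<comment> \<open>The two consecutive sums together contribute \<open>2 * N\<close>; the excess
      makes the comparison strict and ensures \<open>n - 1 \<ge> N\<close>.\<close>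
    define N' where "N' = 2 * N + 3"
    have "\<omega> \<notin> rowmax_ev n {1..n div B} (real N' * thr n)" if n: "n \<ge> N'" for n
    proof
      assume "\<omega> \<in> rowmax_ev n {1..n div B} (real N' * thr n)"
      then obtain i j where ij: "i \<in> {1..n div B}" "j \<in> {1..n div B}" "i \<noteq> j"
          "real N' * thr n \<le> \<bar>U n i \<omega> * V n j \<omega>\<bar>"
        by (auto simp: rowmax_ev_def)
      have n2: "n \<ge> 2" "n - 1 \<ge> N" "n \<ge> N" using n by (auto simp: N'_def)
      have T: "\<bar>\<Sum>k=1..m. U k i \<omega> * V k j \<omega>\<bar> \<le> real N * thr n" if m: "m = n \<or> m = n - 1" for m
      proof -
        have "\<bar>\<Sum>k=1..m. U k i \<omega> * V k j \<omega>\<bar> \<le> Tstat U V p m \<omega>"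
          using ij cols[OF n2(1)] m by (intro Tstat_ge) auto
        also have "\<dots> \<le> real N * thr m" using m n2 by (intro N) auto
        also have "\<dots> \<le> real N * thr n" using m by (intro mult_left_mono thr_mono) auto
        finally show ?thesis .
      qed
      have "{1..n} = insert n {1..n - 1}" using n2 by auto
      then have "(\<Sum>k=1..n. U k i \<omega> * V k j \<omega>) = U n i \<omega> * V n j \<omega> + (\<Sum>k=1..n-1. U k i \<omega> * V k j \<omega>)"
        using n2 by simp
      then have "\<bar>U n i \<omega> * V n j \<omega>\<bar> \<le> 2 * (real N * thr n)" using T[of n] T[of "n - 1"] by linarith
      also have "\<dots> < real N' * thr n" using thr_pos[OF n2(1)] by (simp add: N'_def algebra_simps)
      finally show False using ij by simp
    qed
    then show ?case by blast
  qed
  then obtain C where C: "C > 0" "summable (\<lambda>n. rowmax_prob (n div B) (C * thr n))"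
    using summable_of_AE_no_rowmax[of "\<lambda>n. n div B"] by blast
  \<comment> \<open>Both defects are repaired at once: too few columns, \<open>n div B\<close>, and
    the unknown constant \<open>C\<close>.\<close>
  have "summable (\<lambda>n. rowmax_prob (1 * n) (1 * thr n))"
  proof (rule summable_rowmax_rescale[OF C(2,1)])
    fix m assume m: "m \<ge> B"
    have "m = m div B * B + m mod B" by simp
    moreover have "m mod B < B" "m div B \<ge> 1" using \<open>B > 0\<close> m by (auto simp: Suc_le_eq div_greater_zero_iff)
    moreover have "B \<le> m div B * B" using \<open>m div B \<ge> 1\<close> by simp
    ultimately have "m \<le> m div B * B + m div B * B" by linarith
    then show "m \<le> (2 * B) * (m div B)" by (simp add: algebra_simps)
  qed simp
  then show sum: "summable (\<lambda>n. rowmax_prob n (thr n))" by simp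
  obtain D where "D \<ge> 0" "\<And>y. y \<ge> 1 \<Longrightarrow> tail y \<le> D * y powr (-8/3)"
    using tail_bound[OF sum] by blast
  then show sq: "(\<integral>\<^sup>+\<omega>. ennreal ((U 1 1 \<omega> * V 1 2 \<omega>)\<^sup>2) \<partial>M) < \<infinity>"
    by (rule nn_integral_square_finite)
  have "integrable M (\<lambda>\<omega>. (U 1 1 \<omega> * V 1 2 \<omega>)\<^sup>2)"
    using sq measurable_UV[of 1 1 2] by (intro integrableI_nonneg) auto
  then show "expectation (\<lambda>\<omega>. U 1 1 \<omega> * V 1 2 \<omega>) = 0"
  proof (rule mean_zero)
    show "AE \<omega> in M. \<exists>N. \<forall>n\<ge>N. \<bar>\<Sum>k=1..n. U k 1 \<omega> * V k 2 \<omega>\<bar> \<le> real N * thr n"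
      using bdd
    proof eventually_elim
      case (elim \<omega>)
      then obtain N where N: "\<And>n. n \<ge> N \<Longrightarrow> Tstat U V p n \<omega> \<le> real N * thr n" by blast
      \<comment> \<open>The summand \<open>2 * B\<close> guarantees that columns 1 and 2 are both
        among the first \<open>p n\<close>.\<close>
      define N' where "N' = N + 2 * B + 1"
      have "\<bar>\<Sum>k=1..n. U k 1 \<omega> * V k 2 \<omega>\<bar> \<le> real N' * thr n" if n: "n \<ge> N'" for n
      proof -
        have "2 \<le> n div B" using n \<open>B > 0\<close> by (simp add: N'_def less_eq_div_iff_mult_less_eq)
        then have "2 \<le> p n" using cols[of n] n \<open>B > 0\<close> by (simp add: N'_def)
        then have "\<bar>\<Sum>k=1..n. U k 1 \<omega> * V k 2 \<omega>\<bar> \<le> Tstat U V p n \<omega>" by (intro Tstat_ge) auto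
        also have "\<dots> \<le> real N * thr n" using n by (intro N) (simp add: N'_def)
        also have "\<dots> \<le> real N' * thr n" by (intro mult_right_mono) (auto simp: N'_def thr_nonneg)
        finally show ?thesis .
      qed
      then show ?case by blast
    qed
  qed
qed

subsection \<open>Sufficiency: large products\<close>

text \<open>The summability condition pays for one row per n, but here every row up to n must be
  good, and a union over n rows for every n would be too expensive. At dyadic times the 2^(m+1) rows
  are charged to the 2^m terms of the series in that block.\<close>

lemma AE_products_le:
  assumes sum: "summable (\<lambda>n. rowmax_prob n (thr n))" and "\<epsilon> > 0"
  shows "AE \<omega> in M. \<forall>\<^sub>F n in sequentially. \<forall>l\<in>{1..n}. \<forall>i\<in>{1..c * n}. \<forall>j\<in>{1..c * n}. i \<noteq> j \<longrightarrow>
    \<bar>U l i \<omega> * V l j \<omega>\<bar> \<le> \<epsilon> * thr n"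
proof -
  define E where "E = (\<lambda>m. \<Union>l\<in>{1..2 ^ Suc m}. rowmax_ev l {1..c * 2 ^ Suc m} (\<epsilon> / 2 * thr (2 ^ Suc m)))"
  \<comment> \<open>For n in the m-th block, 2 c n columns include the c 2^(m+1) columns of
    \<open>E m\<close>. Half of \<open>\<epsilon>\<close> is reserved for
    \<open>thr (2 * n) \<le> 2 * thr n\<close>, used when returning from dyadic times to n.\<close>
  define h where "h = (\<lambda>n. rowmax_prob (2 * c * n) (\<epsilon> / 2 * thr n))"
  have h: "summable h" unfolding h_def
  proof (rule summable_rowmax_rescale)
    show "summable (\<lambda>n. rowmax_prob n (1 * thr n))" using sum by simp
    show "m \<le> 1 * m" for m :: nat by simp
  qed (use \<open>\<epsilon> > 0\<close> in auto)
  have E: "E m \<in> sets M" for m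
    unfolding E_def by (intro sets.finite_UN rowmax_ev_sets) auto
  have "prob (E m) \<le> 2 * (\<Sum>n\<in>{2 ^ m..<2 ^ Suc m}. h n)" for m
  proof -
    define r where "r = rowmax_prob (c * 2 ^ Suc m) (\<epsilon> / 2 * thr (2 ^ Suc m))"
    have "prob (E m) \<le> (\<Sum>l\<in>{1..2 ^ Suc m}. prob (rowmax_ev l {1..c * 2 ^ Suc m} (\<epsilon> / 2 * thr (2 ^ Suc m))))"
      unfolding E_def by (intro measure_UNION_le rowmax_ev_sets) auto
    also have "\<dots> = (\<Sum>l\<in>{1..2 ^ Suc m :: nat}. r)"
      by (intro sum.cong refl, subst prob_rowmax_ev_card) (auto simp: r_def)
    also have "\<dots> = 2 * (\<Sum>n\<in>{2 ^ m..<2 ^ Suc m :: nat}. r)" by simp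
    also have "\<dots> \<le> 2 * (\<Sum>n\<in>{2 ^ m..<2 ^ Suc m}. h n)"
    proof (intro mult_left_mono sum_mono)
      fix n :: nat assume n: "n \<in> {2 ^ m..<2 ^ Suc m}"
      have "c * 2 ^ Suc m \<le> 2 * c * n" using n by simp
      moreover have "\<epsilon> / 2 * thr n \<le> \<epsilon> / 2 * thr (2 ^ Suc m)"
        using n \<open>\<epsilon> > 0\<close> by (intro mult_left_mono thr_mono) auto
      ultimately show "r \<le> h n" unfolding r_def h_def by (intro rowmax_prob_mono)
    qed simp
    finally show ?thesis .
  qed
  then have "summable (\<lambda>m. prob (E m))"
    by (intro summable_dyadic[OF h]) (auto simp: h_def rowmax_prob_nonneg)
  then have "AE \<omega> in M. \<forall>\<^sub>F m in sequentially. \<omega> \<in> space M - E m"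
    using E by (intro borel_cantelli_AE1) (auto simp: emeasure_eq_measure)
  then show ?thesis
  proof eventually_elim
    case (elim \<omega>)
    then obtain m0 where m0: "\<And>m. m \<ge> m0 \<Longrightarrow> \<omega> \<in> space M - E m" by (auto simp: eventually_sequentially)
    show ?case
    proof (intro eventually_sequentiallyI[of "2 ^ m0 + 2"] ballI impI)
      fix n l i j assume n: "2 ^ m0 + 2 \<le> n" and l: "l \<in> {1..n}"
        and ij: "i \<in> {1..c * n}" "j \<in> {1..c * n}" "i \<noteq> j"
      obtain m where m: "2 ^ m \<le> n" "n < 2 ^ Suc m"
        using ex_power_ivl1[of 2 n] n by auto
      have "m \<ge> m0"
      proof (rule ccontr)
        assume "\<not> m \<ge> m0"
        then have "(2::nat) ^ Suc m \<le> 2 ^ m0" by (intro power_increasing) auto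
        then show False using m n by simp
      qed
      then have \<omega>: "\<omega> \<in> space M" "\<omega> \<notin> rowmax_ev l {1..c * 2 ^ Suc m} (\<epsilon> / 2 * thr (2 ^ Suc m))"
        using m0[of m] l m unfolding E_def by auto
      have "c * n \<le> c * 2 ^ Suc m" using m by (intro mult_left_mono) auto
      then have "i \<in> {1..c * 2 ^ Suc m}" "j \<in> {1..c * 2 ^ Suc m}"
        using ij unfolding atLeastAtMost_iff by linarith+
      then have "\<bar>U l i \<omega> * V l j \<omega>\<bar> < \<epsilon> / 2 * thr (2 ^ Suc m)"
        using ij(3) \<omega> unfolding rowmax_ev_def not_le[symmetric] by blast
      also have "\<dots> \<le> \<epsilon> / 2 * thr (2 * n)"
        using m \<open>\<epsilon> > 0\<close> by (intro mult_left_mono thr_mono) auto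
      also have "\<dots> \<le> \<epsilon> / 2 * (2 * thr n)"
        using thr_mult_le[of 2 n] n \<open>\<epsilon> > 0\<close> by (intro mult_left_mono) auto
      finally show "\<bar>U l i \<omega> * V l j \<omega>\<bar> \<le> \<epsilon> * thr n" by simp
    qed
  qed
qed

text \<open>If \<open>r\<close> products are large, some \<open>r\<close>-set of rows consists of
  large ones. There are at most n^r such sets, and independence gives each the probability
  \<open>tail b ^ r\<close>.\<close>

lemma prob_many_large:
  assumes "i \<ge> 1" "j \<ge> 1" "i \<noteq> j" "r > 0"
  shows "prob {\<omega> \<in> space M. r \<le> card {l\<in>{1..n}. b \<le> \<bar>U l i \<omega> * V l j \<omega>\<bar>}} \<le> (real n * tail b) ^ r"
proof -
  define Y where "Y = (\<lambda>l \<omega>. U l i \<omega> * V l j \<omega>)"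
  define F where "F = {T. T \<subseteq> {1..n} \<and> card T = r}"
  have F: "finite F" "card F = n choose r" unfolding F_def using n_subsets[of "{1..n}" r] by auto
  have Ym: "Y l \<in> borel_measurable M" if "l \<ge> 1" for l
    unfolding Y_def using that assms by (intro measurable_UV) auto
  have ev: "{\<omega> \<in> space M. b \<le> \<bar>Y l \<omega>\<bar>} \<in> sets M" if "l \<ge> 1" for l
    using Ym[OF that] by measurable
  have T: "T \<noteq> {}" "finite T" "T \<subseteq> {1..}" if "T \<in> F" for T
    using that assms(4) finite_subset[of T "{1..n}"] by (auto simp: F_def)
  have Tev: "(\<Inter>l\<in>T. {\<omega> \<in> space M. b \<le> \<bar>Y l \<omega>\<bar>}) \<in> sets M" if "T \<in> F" for T
    using T[OF that] by (intro sets.finite_INT ev) auto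
  have probT: "prob (\<Inter>l\<in>T. {\<omega> \<in> space M. b \<le> \<bar>Y l \<omega>\<bar>}) = tail b ^ r" if "T \<in> F" for T
  proof -
    have "indep_vars (\<lambda>_. borel) Y {1..}" unfolding Y_def by (rule indep_products_rows[OF assms(1,2)])
    then have "prob (\<Inter>l\<in>T. Y l -` {z. b \<le> \<bar>z\<bar>} \<inter> space M) = (\<Prod>l\<in>T. prob (Y l -` {z. b \<le> \<bar>z\<bar>} \<inter> space M))"
      using T[OF that] by (intro indep_varsD) auto
    also have "\<dots> = (\<Prod>l\<in>T. tail b)"
    proof (intro prod.cong refl)
      fix l assume "l \<in> T"
      then have "l \<ge> 1" using T[OF that] by auto
      have "Y l -` {z. b \<le> \<bar>z\<bar>} \<inter> space M = {\<omega> \<in> space M. b \<le> \<bar>U l i \<omega> * V l j \<omega>\<bar>}" by (auto simp: Y_def)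
      then show "prob (Y l -` {z. b \<le> \<bar>z\<bar>} \<inter> space M) = tail b"
        unfolding tail_def using prob_product[of l i j "\<lambda>z. b \<le> \<bar>z\<bar>"] \<open>l \<ge> 1\<close> assms by simp
    qed
    also have "\<dots> = tail b ^ r" using that by (simp add: F_def)
    also have "(\<Inter>l\<in>T. Y l -` {z. b \<le> \<bar>z\<bar>} \<inter> space M) = (\<Inter>l\<in>T. {\<omega> \<in> space M. b \<le> \<bar>Y l \<omega>\<bar>})" by auto
    finally show ?thesis .
  qed
  have "{\<omega> \<in> space M. r \<le> card {l\<in>{1..n}. b \<le> \<bar>Y l \<omega>\<bar>}} \<subseteq> (\<Union>T\<in>F. \<Inter>l\<in>T. {\<omega> \<in> space M. b \<le> \<bar>Y l \<omega>\<bar>})"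
  proof
    fix \<omega> assume \<omega>: "\<omega> \<in> {\<omega> \<in> space M. r \<le> card {l\<in>{1..n}. b \<le> \<bar>Y l \<omega>\<bar>}}"
    then obtain T where "T \<subseteq> {l\<in>{1..n}. b \<le> \<bar>Y l \<omega>\<bar>}" "card T = r"
      using obtain_subset_with_card_n[of r "{l\<in>{1..n}. b \<le> \<bar>Y l \<omega>\<bar>}"] by blast
    then show "\<omega> \<in> (\<Union>T\<in>F. \<Inter>l\<in>T. {\<omega> \<in> space M. b \<le> \<bar>Y l \<omega>\<bar>})"
      using \<omega> by (intro UN_I[of T]) (auto simp: F_def)
  qed
  then have "prob {\<omega> \<in> space M. r \<le> card {l\<in>{1..n}. b \<le> \<bar>Y l \<omega>\<bar>}}
      \<le> prob (\<Union>T\<in>F. \<Inter>l\<in>T. {\<omega> \<in> space M. b \<le> \<bar>Y l \<omega>\<bar>})"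
    using F Tev by (intro finite_measure_mono sets.finite_UN) auto
  also have "\<dots> \<le> (\<Sum>T\<in>F. prob (\<Inter>l\<in>T. {\<omega> \<in> space M. b \<le> \<bar>Y l \<omega>\<bar>}))"
    using F Tev by (intro measure_UNION_le) auto
  also have "\<dots> = real (n choose r) * tail b ^ r" by (simp add: probT F)
  also have "\<dots> \<le> real n ^ r * tail b ^ r"
  proof (intro mult_right_mono)
    have "n choose r \<le> n ^ r" by (cases "r \<le> n") (auto simp: binomial_le_pow binomial_eq_0)
    then show "real (n choose r) \<le> real n ^ r" by (metis of_nat_le_iff of_nat_power)
  qed (simp add: tail_nonneg)
  finally show ?thesis by (simp add: Y_def power_mult_distrib)
qed

subsection \<open>Sufficiency: exponential bounds for truncated sums\<close>

text \<open>Truncation spoils the mean zero. The bias is at most this quantity divided by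
  \<open>b\<close>, and a finite second moment makes it o(1/b).\<close>

definition second_moment_tail :: "real \<Rightarrow> real" where
  "second_moment_tail b = expectation (\<lambda>\<omega>. if b \<le> \<bar>U 1 1 \<omega> * V 1 2 \<omega>\<bar> then (U 1 1 \<omega> * V 1 2 \<omega>)\<^sup>2 else 0)"

lemma second_moment_tail_tendsto:
  assumes sq: "integrable M (\<lambda>\<omega>. (U 1 1 \<omega> * V 1 2 \<omega>)\<^sup>2)"
  shows "(second_moment_tail \<longlongrightarrow> 0) at_top"
proof -
  define Z where "Z = (\<lambda>\<omega>. U 1 1 \<omega> * V 1 2 \<omega>)"
  have [measurable]: "Z \<in> borel_measurable M" unfolding Z_def by (rule measurable_UV) auto
  have "((\<lambda>b. expectation (\<lambda>\<omega>. if b \<le> \<bar>Z \<omega>\<bar> then (Z \<omega>)\<^sup>2 else 0)) \<longlongrightarrow> expectation (\<lambda>\<omega>. 0)) at_top"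
  proof (rule integral_dominated_convergence_at_top)
    show "integrable M (\<lambda>\<omega>. (Z \<omega>)\<^sup>2)" using sq by (simp add: Z_def)
    show "AE \<omega> in M. ((\<lambda>b. if b \<le> \<bar>Z \<omega>\<bar> then (Z \<omega>)\<^sup>2 else 0) \<longlongrightarrow> 0) at_top"
    proof (intro AE_I2 tendsto_eventually)
      fix \<omega>
      show "\<forall>\<^sub>F b in at_top. (if b \<le> \<bar>Z \<omega>\<bar> then (Z \<omega>)\<^sup>2 else 0) = 0"
        using eventually_gt_at_top[of "\<bar>Z \<omega>\<bar>"] by eventually_elim auto
    qed
  qed auto
  then show ?thesis unfolding second_moment_tail_def[abs_def] Z_def by simp
qed

text \<open>On integrating the quadratic bound for exp, the linear term leaves only the bias, and
  the quadratic term is bounded by the full second moment 1. The exponential form of the result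
  multiplies over rows.\<close>

lemma mgf_trunc_le:
  assumes sq: "integrable M (\<lambda>\<omega>. (U 1 1 \<omega> * V 1 2 \<omega>)\<^sup>2)"
    and mean: "expectation (\<lambda>\<omega>. U 1 1 \<omega> * V 1 2 \<omega>) = 0"
    and var: "expectation (\<lambda>\<omega>. (U 1 1 \<omega> * V 1 2 \<omega>)\<^sup>2) = 1"
    and b: "b > 0"
  shows "expectation (\<lambda>\<omega>. exp (t * trunc b (U 1 1 \<omega> * V 1 2 \<omega>)))
    \<le> exp (\<bar>t\<bar> * second_moment_tail b / b + t\<^sup>2 / 2 * exp (\<bar>t\<bar> * b))"
proof -
  define Z where "Z = (\<lambda>\<omega>. U 1 1 \<omega> * V 1 2 \<omega>)"
  define R where "R = (\<lambda>\<omega>. if b \<le> \<bar>Z \<omega>\<bar> then (Z \<omega>)\<^sup>2 else 0)"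
  have Zm[measurable]: "Z \<in> borel_measurable M" unfolding Z_def by (rule measurable_UV) auto
  have sq': "integrable M (\<lambda>\<omega>. (Z \<omega>)\<^sup>2)" using sq by (simp add: Z_def)
  have intZ: "integrable M Z" by (rule square_integrable_imp_integrable[OF Zm sq'])
  have intT: "integrable M (\<lambda>\<omega>. trunc b (Z \<omega>))"
    by (rule integrable_const_bound[where B = b]) (use b in \<open>auto simp: abs_trunc_le\<close>)
  have intR: "integrable M R"
    by (rule Bochner_Integration.integrable_bound[OF sq']) (auto simp: R_def)
  have ET: "\<bar>expectation (\<lambda>\<omega>. trunc b (Z \<omega>))\<bar> \<le> second_moment_tail b / b"
  proof -
    \<comment> \<open>Subtracting \<open>Z\<close>, of mean 0, leaves only the part with |Z| >= b,
      where |Z| <= Z^2 / b.\<close>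
    have "expectation (\<lambda>\<omega>. trunc b (Z \<omega>)) = expectation (\<lambda>\<omega>. trunc b (Z \<omega>) - Z \<omega>)"
      using intT intZ mean by (simp add: Z_def)
    also have "\<bar>\<dots>\<bar> \<le> expectation (\<lambda>\<omega>. \<bar>trunc b (Z \<omega>) - Z \<omega>\<bar>)" by (rule integral_abs_bound)
    also have "\<dots> \<le> expectation (\<lambda>\<omega>. R \<omega> / b)"
    proof (rule integral_mono)
      fix \<omega>
      have "b * \<bar>Z \<omega>\<bar> \<le> \<bar>Z \<omega>\<bar> * \<bar>Z \<omega>\<bar>" if "b \<le> \<bar>Z \<omega>\<bar>" using that by (intro mult_right_mono) auto
      then show "\<bar>trunc b (Z \<omega>) - Z \<omega>\<bar> \<le> R \<omega> / b"
        using b by (auto simp: trunc_def R_def field_simps power2_eq_square not_less)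
    qed (use intT intZ intR in auto)
    also have "\<dots> = second_moment_tail b / b" unfolding second_moment_tail_def R_def Z_def by simp
    finally show ?thesis .
  qed
  have pt: "exp (t * trunc b (Z \<omega>)) \<le> 1 + t * trunc b (Z \<omega>) + t\<^sup>2 / 2 * exp (\<bar>t\<bar> * b) * (Z \<omega>)\<^sup>2" for \<omega>
  proof -
    have "\<bar>t * trunc b (Z \<omega>)\<bar> \<le> \<bar>t\<bar> * b" using b abs_trunc_le[of b] by (simp add: abs_mult mult_left_mono)
    moreover have "(t * trunc b (Z \<omega>))\<^sup>2 \<le> t\<^sup>2 * (Z \<omega>)\<^sup>2"
      by (simp add: power_mult_distrib mult_left_mono trunc_sq_le)
    ultimately have "(t * trunc b (Z \<omega>))\<^sup>2 / 2 * exp \<bar>t * trunc b (Z \<omega>)\<bar> \<le> (t\<^sup>2 * (Z \<omega>)\<^sup>2) / 2 * exp (\<bar>t\<bar> * b)"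
      by (intro mult_mono divide_right_mono) auto
    then show ?thesis using exp_le_quadratic[of "t * trunc b (Z \<omega>)"] by (simp add: algebra_simps)
  qed
  have "expectation (\<lambda>\<omega>. exp (t * trunc b (Z \<omega>)))
      \<le> expectation (\<lambda>\<omega>. 1 + t * trunc b (Z \<omega>) + t\<^sup>2 / 2 * exp (\<bar>t\<bar> * b) * (Z \<omega>)\<^sup>2)"
  proof (rule integral_mono)
    have "\<bar>t * trunc b (Z \<omega>)\<bar> \<le> \<bar>t\<bar> * b" for \<omega>
      using b abs_trunc_le[of b] by (simp add: abs_mult mult_left_mono)
    then show "integrable M (\<lambda>\<omega>. exp (t * trunc b (Z \<omega>)))"
      by (intro integrable_const_bound[where B = "exp (\<bar>t\<bar> * b)"]) (auto simp: abs_le_iff)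
    show "integrable M (\<lambda>\<omega>. 1 + t * trunc b (Z \<omega>) + t\<^sup>2 / 2 * exp (\<bar>t\<bar> * b) * (Z \<omega>)\<^sup>2)"
      using intT sq' by simp
  qed (rule pt)
  also have "\<dots> = 1 + t * expectation (\<lambda>\<omega>. trunc b (Z \<omega>)) + t\<^sup>2 / 2 * exp (\<bar>t\<bar> * b)"
    using intT sq' var by (simp add: prob_space Z_def)
  also have "t * expectation (\<lambda>\<omega>. trunc b (Z \<omega>)) \<le> \<bar>t\<bar> * (second_moment_tail b / b)"
  proof -
    have "t * expectation (\<lambda>\<omega>. trunc b (Z \<omega>)) \<le> \<bar>t * expectation (\<lambda>\<omega>. trunc b (Z \<omega>))\<bar>" by simp
    also have "\<dots> \<le> \<bar>t\<bar> * (second_moment_tail b / b)" unfolding abs_mult using ET by (intro mult_left_mono) auto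
    finally show ?thesis .
  qed
  also have "1 + \<bar>t\<bar> * (second_moment_tail b / b) + t\<^sup>2 / 2 * exp (\<bar>t\<bar> * b)
      \<le> exp (\<bar>t\<bar> * second_moment_tail b / b + t\<^sup>2 / 2 * exp (\<bar>t\<bar> * b))"
    using exp_ge_add_one_self[of "\<bar>t\<bar> * second_moment_tail b / b + t\<^sup>2 / 2 * exp (\<bar>t\<bar> * b)"]
    by (simp add: add.assoc)
  finally show ?thesis by (simp add: Z_def)
qed

text \<open>Chernoff's bound, applied with both signs \<open>s\<close>. The rows form an arbitrary
  finite set, to cover full sums and increments alike.\<close>

lemma prob_sum_trunc_ge:
  assumes sq: "integrable M (\<lambda>\<omega>. (U 1 1 \<omega> * V 1 2 \<omega>)\<^sup>2)"
    and mean: "expectation (\<lambda>\<omega>. U 1 1 \<omega> * V 1 2 \<omega>) = 0"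
    and var: "expectation (\<lambda>\<omega>. (U 1 1 \<omega> * V 1 2 \<omega>)\<^sup>2) = 1"
    and b: "b > 0" and t: "t > 0" and K: "finite K" "K \<subseteq> {1..}"
    and ij: "i \<ge> 1" "j \<ge> 1" "i \<noteq> j"
  shows "prob {\<omega> \<in> space M. x \<le> \<bar>\<Sum>k\<in>K. trunc b (U k i \<omega> * V k j \<omega>)\<bar>}
    \<le> 2 * exp (- (t * x) + real (card K) * (t * second_moment_tail b / b + t\<^sup>2 / 2 * exp (t * b)))"
proof -
  define Y where "Y = (\<lambda>k \<omega>. trunc b (U k i \<omega> * V k j \<omega>))"
  define m where "m = t * second_moment_tail b / b + t\<^sup>2 / 2 * exp (t * b)"
  have Ym: "Y k \<in> borel_measurable M" if "k \<in> K" for k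
    unfolding Y_def using that K ij by (intro measurable_compose[OF measurable_UV measurable_trunc]) auto
  have Sm[measurable]: "(\<lambda>\<omega>. \<Sum>k\<in>K. Y k \<omega>) \<in> borel_measurable M" by (intro borel_measurable_sum Ym)
  have one: "prob {\<omega> \<in> space M. x \<le> s * (\<Sum>k\<in>K. Y k \<omega>)} \<le> exp (- (t * x) + real (card K) * m)"
    if s: "\<bar>s\<bar> = 1" for s
  proof -
    have indep: "indep_vars (\<lambda>_. borel) (\<lambda>k \<omega>. exp (t * s * Y k \<omega>)) K"
    proof -
      have "indep_vars (\<lambda>_. borel) (\<lambda>k \<omega>. U k i \<omega> * V k j \<omega>) K"
        by (rule indep_vars_subset[OF indep_products_rows[OF ij(1,2)] K(2)])
      then show ?thesis unfolding Y_def
        by (rule indep_vars_compose2[where Y = "\<lambda>_ z. exp (t * s * trunc b z)"]) measurable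
    qed
    have int: "integrable M (\<lambda>\<omega>. exp (t * s * Y k \<omega>))" if "k \<in> K" for k
    proof (rule integrable_const_bound[where B = "exp (t * b)"])
      have "t * s * Y k \<omega> \<le> t * b" for \<omega>
      proof -
        have "t * s * Y k \<omega> \<le> \<bar>t * s * Y k \<omega>\<bar>" by simp
        also have "\<dots> = t * \<bar>Y k \<omega>\<bar>" using s t by (simp add: abs_mult)
        also have "\<dots> \<le> t * b" using t b by (intro mult_left_mono) (auto simp: Y_def abs_trunc_le)
        finally show ?thesis .
      qed
      then show "AE \<omega> in M. norm (exp (t * s * Y k \<omega>)) \<le> exp (t * b)" by simp
      show "(\<lambda>\<omega>. exp (t * s * Y k \<omega>)) \<in> borel_measurable M" using Ym[OF that] by measurable
    qed
    have E: "expectation (\<lambda>\<omega>. exp (t * s * Y k \<omega>)) \<le> exp m" if "k \<in> K" for k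
    proof -
      have "expectation (\<lambda>\<omega>. exp (t * s * Y k \<omega>)) = expectation (\<lambda>\<omega>. exp (t * s * trunc b (U 1 1 \<omega> * V 1 2 \<omega>)))"
        unfolding Y_def using that K ij
        by (intro expectation_product[where h = "\<lambda>z. exp (t * s * trunc b z)"]) auto
      also have "\<dots> \<le> exp (\<bar>t * s\<bar> * second_moment_tail b / b + (t * s)\<^sup>2 / 2 * exp (\<bar>t * s\<bar> * b))"
        by (rule mgf_trunc_le[OF sq mean var b])
      also have "\<bar>t * s\<bar> = t" using s t by (simp add: abs_mult)
      also have "(t * s)\<^sup>2 = t\<^sup>2" using s power2_abs[of s] by (simp add: power_mult_distrib)
      finally show ?thesis by (simp add: m_def)
    qed
    have prodE: "integrable M (\<lambda>\<omega>. exp (t * s * (\<Sum>k\<in>K. Y k \<omega>)))"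
        "expectation (\<lambda>\<omega>. exp (t * s * (\<Sum>k\<in>K. Y k \<omega>))) = (\<Prod>k\<in>K. expectation (\<lambda>\<omega>. exp (t * s * Y k \<omega>)))"
    proof -
      have "exp (t * s * (\<Sum>k\<in>K. Y k \<omega>)) = (\<Prod>k\<in>K. exp (t * s * Y k \<omega>))" for \<omega>
        by (simp add: sum_distrib_left exp_sum K(1))
      then show "integrable M (\<lambda>\<omega>. exp (t * s * (\<Sum>k\<in>K. Y k \<omega>)))"
        "expectation (\<lambda>\<omega>. exp (t * s * (\<Sum>k\<in>K. Y k \<omega>))) = (\<Prod>k\<in>K. expectation (\<lambda>\<omega>. exp (t * s * Y k \<omega>)))"
        using indep_vars_integrable[OF K(1) indep int] indep_vars_lebesgue_integral[OF K(1) indep int] by simp_all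
    qed
    have "{\<omega> \<in> space M. x \<le> s * (\<Sum>k\<in>K. Y k \<omega>)} = {\<omega> \<in> space M. exp (t * x) \<le> exp (t * s * (\<Sum>k\<in>K. Y k \<omega>))}"
      using t by (simp add: mult.assoc)
    then have "prob {\<omega> \<in> space M. x \<le> s * (\<Sum>k\<in>K. Y k \<omega>)}
        = prob {\<omega> \<in> space M. exp (t * x) \<le> exp (t * s * (\<Sum>k\<in>K. Y k \<omega>))}" by simp
    also have "\<dots> \<le> expectation (\<lambda>\<omega>. exp (t * s * (\<Sum>k\<in>K. Y k \<omega>))) / exp (t * x)"
      by (rule integral_Markov_inequality_measure[OF prodE(1), of "space M"]) auto
    also have "\<dots> \<le> exp m ^ card K / exp (t * x)"
    proof (rule divide_right_mono)
      have "(\<Prod>k\<in>K. expectation (\<lambda>\<omega>. exp (t * s * Y k \<omega>))) \<le> (\<Prod>k\<in>K. exp m)"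
        by (intro prod_mono conjI E) (auto intro!: integral_nonneg_AE)
      then show "expectation (\<lambda>\<omega>. exp (t * s * (\<Sum>k\<in>K. Y k \<omega>))) \<le> exp m ^ card K"
        using prodE(2) by simp
    qed simp
    also have "\<dots> = exp (- (t * x) + real (card K) * m)"
      by (simp add: exp_of_nat_mult[symmetric] exp_diff[symmetric])
    finally show ?thesis .
  qed
  have "prob {\<omega> \<in> space M. x \<le> \<bar>\<Sum>k\<in>K. Y k \<omega>\<bar>}
      \<le> prob ({\<omega> \<in> space M. x \<le> 1 * (\<Sum>k\<in>K. Y k \<omega>)} \<union> {\<omega> \<in> space M. x \<le> (-1) * (\<Sum>k\<in>K. Y k \<omega>)})"
    by (intro finite_measure_mono) auto
  also have "\<dots> \<le> prob {\<omega> \<in> space M. x \<le> 1 * (\<Sum>k\<in>K. Y k \<omega>)} + prob {\<omega> \<in> space M. x \<le> (-1) * (\<Sum>k\<in>K. Y k \<omega>)}"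
    by (intro measure_Un_le) measurable
  also have "\<dots> \<le> 2 * exp (- (t * x) + real (card K) * m)"
    using one[of 1] one[of "-1"] by simp
  finally show ?thesis by (simp add: Y_def m_def)
qed

text \<open>With the tilting parameter of order \<open>sqrt (ln n / n)\<close> used in the next lemma, its product with
  the truncation level is constant.\<close>

definition level :: "real \<Rightarrow> nat \<Rightarrow> real" where
  "level \<delta> n = \<delta> * sqrt (real n / ln (real n))"

text \<open>For t = \<open>\<alpha> * sqrt (ln n / n)\<close> all terms of the exponent are
  multiples of ln n: the threshold gives \<open>\<alpha> * \<xi>\<close>, the variance costs
  \<open>\<kappa> * (\<alpha>\<^sup>2 / 2 * exp (\<alpha> * \<delta>))\<close>, and the bias costs a
  multiple of \<open>w n\<close>, which tends to 0 and fits into the strict gap. Here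
  \<open>\<kappa>\<close> is the proportion of rows involved: 1 for full sums, small for increments.
  Uniformity in rows and columns is what the later union bounds need.\<close>

lemma eventually_prob_sum_trunc_ge:
  assumes sq: "integrable M (\<lambda>\<omega>. (U 1 1 \<omega> * V 1 2 \<omega>)\<^sup>2)"
    and mean: "expectation (\<lambda>\<omega>. U 1 1 \<omega> * V 1 2 \<omega>) = 0"
    and var: "expectation (\<lambda>\<omega>. (U 1 1 \<omega> * V 1 2 \<omega>)\<^sup>2) = 1"
    and pos: "\<delta> > 0" "\<alpha> > 0" "\<kappa> > 0" and gap: "\<gamma> < \<alpha> * \<xi> - \<kappa> * (\<alpha>\<^sup>2 / 2 * exp (\<alpha> * \<delta>))"
  shows "\<forall>\<^sub>F n in sequentially. \<forall>K i j. finite K \<and> K \<subseteq> {1..} \<and> real (card K) \<le> \<kappa> * real n \<and> i \<ge> 1 \<and> j \<ge> 1 \<and> i \<noteq> j \<longrightarrow>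
    prob {\<omega> \<in> space M. \<xi> * thr n \<le> \<bar>\<Sum>k\<in>K. trunc (level \<delta> n) (U k i \<omega> * V k j \<omega>)\<bar>} \<le> 2 * real n powr (- \<gamma>)"
proof -
  define w where "w = (\<lambda>n. second_moment_tail (level \<delta> n))"
  have "filterlim (level \<delta>) at_top sequentially"
    unfolding level_def[abs_def] using pos(1) by real_asymp
  then have "w \<longlonglongrightarrow> 0"
    unfolding w_def by (rule filterlim_compose[OF second_moment_tail_tendsto[OF sq]])
  then have "(\<lambda>n. \<kappa> * (\<alpha> / \<delta> * w n)) \<longlonglongrightarrow> \<kappa> * (\<alpha> / \<delta> * 0)" by (intro tendsto_intros)
  moreover have "\<kappa> * (\<alpha> / \<delta> * 0) < \<alpha> * \<xi> - \<kappa> * (\<alpha>\<^sup>2 / 2 * exp (\<alpha> * \<delta>)) - \<gamma>" using gap by simp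
  ultimately have "\<forall>\<^sub>F n in sequentially. \<kappa> * (\<alpha> / \<delta> * w n) < \<alpha> * \<xi> - \<kappa> * (\<alpha>\<^sup>2 / 2 * exp (\<alpha> * \<delta>)) - \<gamma>"
    by (rule order_tendstoD(2))
  then show ?thesis
    using eventually_ge_at_top[of 2]
  proof eventually_elim
    case (elim n)
    show ?case
    proof (intro allI impI)
      fix K :: "nat set" and i j :: nat assume A: "finite K \<and> K \<subseteq> {1..} \<and> real (card K) \<le> \<kappa> * real n \<and> i \<ge> 1 \<and> j \<ge> 1 \<and> i \<noteq> j"
      define L where "L = ln (real n)"
      define t where "t = \<alpha> * sqrt (L / real n)"
      define b where "b = level \<delta> n"
      have n: "real n > 0" and L: "L > 0" using elim by (auto simp: L_def)
      have t: "t > 0" using n L pos by (simp add: t_def)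
      have b: "b > 0" using n L pos by (simp add: b_def level_def L_def)
      have w: "w n \<ge> 0" by (auto simp: w_def second_moment_tail_def intro!: integral_nonneg_AE)
      have sL: "sqrt L * sqrt L = L" and sn: "sqrt (real n) * sqrt (real n) = real n" using L n by auto
      have tx: "t * (\<xi> * thr n) = \<alpha> * \<xi> * L"
        using n L by (simp add: t_def thr_def L_def[symmetric] real_sqrt_divide real_sqrt_mult field_simps sL)
      have tb: "t * b = \<alpha> * \<delta>"
        using n L by (simp add: t_def b_def level_def L_def[symmetric] real_sqrt_divide)
      have t_b: "t / b = \<alpha> / \<delta> * L / real n"
        using n L by (simp add: t_def b_def level_def L_def[symmetric] real_sqrt_divide field_simps sL sn)
      have t2: "t\<^sup>2 = \<alpha>\<^sup>2 * L / real n"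
        using n L by (simp add: t_def power_mult_distrib)
      have "real (card K) * (t * w n / b + t\<^sup>2 / 2 * exp (t * b)) \<le> (\<kappa> * real n) * (t * w n / b + t\<^sup>2 / 2 * exp (t * b))"
        using A t b w by (intro mult_right_mono) auto
      also have "t * w n / b = (t / b) * w n" by simp
      also have "(\<kappa> * real n) * ((t / b) * w n + t\<^sup>2 / 2 * exp (t * b))
          = L * (\<kappa> * (\<alpha> / \<delta> * w n) + \<kappa> * (\<alpha>\<^sup>2 / 2 * exp (\<alpha> * \<delta>)))"
        unfolding t_b t2 tb using n pos by (simp add: field_simps)
      also have "\<dots> \<le> L * (\<alpha> * \<xi> - \<gamma>)"
        using elim(1) L by (intro mult_left_mono) auto
      finally have "- (t * (\<xi> * thr n)) + real (card K) * (t * w n / b + t\<^sup>2 / 2 * exp (t * b)) \<le> - \<gamma> * L"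
        unfolding tx by (simp add: algebra_simps)
      then have "2 * exp (- (t * (\<xi> * thr n)) + real (card K) * (t * w n / b + t\<^sup>2 / 2 * exp (t * b))) \<le> 2 * exp (- \<gamma> * L)"
        by simp
      also have "exp (- \<gamma> * L) = real n powr (- \<gamma>)" using n by (simp add: powr_def L_def)
      finally show "prob {\<omega> \<in> space M. \<xi> * thr n \<le> \<bar>\<Sum>k\<in>K. trunc (level \<delta> n) (U k i \<omega> * V k j \<omega>)\<bar>} \<le> 2 * real n powr (- \<gamma>)"
        using prob_sum_trunc_ge[OF sq mean var b t, of K i j "\<xi> * thr n"] A unfolding w_def b_def by linarith
    qed
  qed
qed

subsection \<open>Sufficiency: almost sure bounds\<close>

text \<open>A union bound over at most \<open>(g n)\<^sup>2\<close> pairs followed by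
  Borel-Cantelli. The index may be the time itself or the number of a member of a sparse
  sequence.\<close>

lemma AE_eventually_no_pair:
  fixes P :: "nat \<Rightarrow> nat \<Rightarrow> nat \<Rightarrow> 'a \<Rightarrow> bool" and g :: "nat \<Rightarrow> nat"
  assumes meas: "\<And>n i j. i \<ge> 1 \<Longrightarrow> j \<ge> 1 \<Longrightarrow> {\<omega> \<in> space M. P n i j \<omega>} \<in> sets M"
    and le: "\<forall>\<^sub>F n in sequentially. \<forall>i j. i \<ge> 1 \<and> j \<ge> 1 \<and> i \<noteq> j \<longrightarrow> prob {\<omega> \<in> space M. P n i j \<omega>} \<le> r n"
    and sum: "summable (\<lambda>n. (real (g n))\<^sup>2 * r n)" and r: "\<And>n. 0 \<le> r n"
  shows "AE \<omega> in M. \<forall>\<^sub>F n in sequentially. \<forall>i\<in>{1..g n}. \<forall>j\<in>{1..g n}. i \<noteq> j \<longrightarrow> \<not> P n i j \<omega>"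
proof -
  define I where "I = (\<lambda>n. {ij \<in> {1..g n} \<times> {1..g n}. fst ij \<noteq> snd ij})"
  define A where "A = (\<lambda>n. \<Union>ij\<in>I n. {\<omega> \<in> space M. P n (fst ij) (snd ij) \<omega>})"
  have I: "finite (I n)" "\<And>ij. ij \<in> I n \<Longrightarrow> fst ij \<ge> 1 \<and> snd ij \<ge> 1 \<and> fst ij \<noteq> snd ij" for n
    by (auto simp: I_def)
  have ev: "{\<omega> \<in> space M. P n (fst ij) (snd ij) \<omega>} \<in> sets M" if "ij \<in> I n" for n ij
    using I(2)[OF that] by (intro meas) auto
  have A: "A n \<in> sets M" for n
    unfolding A_def using I(1) ev by (intro sets.finite_UN) auto
  have "\<forall>\<^sub>F n in sequentially. norm (prob (A n)) \<le> (real (g n))\<^sup>2 * r n"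
    using le
  proof eventually_elim
    case (elim n)
    have "prob (A n) \<le> (\<Sum>ij\<in>I n. prob {\<omega> \<in> space M. P n (fst ij) (snd ij) \<omega>})"
      unfolding A_def using I(1) ev by (intro measure_UNION_le)
    also have "\<dots> \<le> (\<Sum>ij\<in>I n. r n)" using elim I(2) by (intro sum_mono) blast
    also have "\<dots> = real (card (I n)) * r n" by simp
    also have "\<dots> \<le> (real (g n))\<^sup>2 * r n"
    proof (intro mult_right_mono r)
      have "card (I n) \<le> card ({1..g n} \<times> {1..g n})" by (intro card_mono) (auto simp: I_def)
      then show "real (card (I n)) \<le> (real (g n))\<^sup>2"
        by (simp add: power2_eq_square flip: of_nat_mult)
    qed
    finally show ?case by simp
  qed
  then have "summable (\<lambda>n. prob (A n))" by (rule summable_comparison_test_ev[OF _ sum])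
  then have "AE \<omega> in M. \<forall>\<^sub>F n in sequentially. \<omega> \<in> space M - A n"
    using A by (intro borel_cantelli_AE1) (auto simp: emeasure_eq_measure)
  then show ?thesis
  proof eventually_elim
    case (elim \<omega>)
    then show ?case
    proof eventually_elim
      case (elim n)
      show ?case
      proof (intro ballI impI notI)
        fix i j assume ij: "i \<in> {1..g n}" "j \<in> {1..g n}" "i \<noteq> j" "P n i j \<omega>"
        then have "(i, j) \<in> I n" by (simp add: I_def)
        moreover have "\<omega> \<in> {\<omega> \<in> space M. P n (fst (i, j)) (snd (i, j)) \<omega>}" using elim ij by simp
        ultimately have "\<omega> \<in> A n" unfolding A_def by (rule UN_I)
        then show False using elim by simp
      qed
    qed
  qed
qed

text \<open>Up to logarithms \<open>tail (level \<delta> n)\<close> is of order n^(-4/3), so ten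
  exceptions cost n^(-10/3) and the pairs return n^2, leaving n^(-4/3). With nine one would be left
  with 1/n times a power of the logarithm, which diverges.\<close>

lemma AE_few_large:
  assumes C: "C \<ge> 0" "\<And>y. y \<ge> 1 \<Longrightarrow> tail y \<le> C * y powr (-8/3)" and "\<delta> > 0"
  shows "AE \<omega> in M. \<forall>\<^sub>F n in sequentially. \<forall>i\<in>{1..c * n}. \<forall>j\<in>{1..c * n}. i \<noteq> j \<longrightarrow>
    \<not> 10 \<le> card {l\<in>{1..n}. level \<delta> n \<le> \<bar>U l i \<omega> * V l j \<omega>\<bar>}"
proof (rule AE_eventually_no_pair)
  fix n i j :: nat assume ij: "i \<ge> 1" "j \<ge> 1"
  have [measurable]: "(\<lambda>\<omega>. U l i \<omega> * V l j \<omega>) \<in> borel_measurable M" if "l \<in> {1..n}" for l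
    using that ij by (intro measurable_UV) auto
  have eq: "real (card {l\<in>{1..n}. level \<delta> n \<le> \<bar>U l i \<omega> * V l j \<omega>\<bar>})
      = (\<Sum>l\<in>{1..n}. if level \<delta> n \<le> \<bar>U l i \<omega> * V l j \<omega>\<bar> then 1 else 0)" for \<omega>
    by (subst sum.inter_filter[symmetric]) auto
  have "(\<lambda>\<omega>. \<Sum>l\<in>{1..n}. if level \<delta> n \<le> \<bar>U l i \<omega> * V l j \<omega>\<bar> then 1 else (0 :: real)) \<in> borel_measurable M"
    by (intro borel_measurable_sum) measurable
  then have "{\<omega> \<in> space M. 10 \<le> (\<Sum>l\<in>{1..n}. if level \<delta> n \<le> \<bar>U l i \<omega> * V l j \<omega>\<bar> then 1 else (0 :: real))} \<in> sets M"
    by measurable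
  also have "{\<omega> \<in> space M. 10 \<le> (\<Sum>l\<in>{1..n}. if level \<delta> n \<le> \<bar>U l i \<omega> * V l j \<omega>\<bar> then 1 else (0 :: real))}
      = {\<omega> \<in> space M. 10 \<le> card {l\<in>{1..n}. level \<delta> n \<le> \<bar>U l i \<omega> * V l j \<omega>\<bar>}}"
    unfolding eq[symmetric] by auto
  finally show "{\<omega> \<in> space M. 10 \<le> card {l\<in>{1..n}. level \<delta> n \<le> \<bar>U l i \<omega> * V l j \<omega>\<bar>}} \<in> sets M" .
next
  show "\<forall>\<^sub>F n in sequentially. \<forall>i j. i \<ge> 1 \<and> j \<ge> 1 \<and> i \<noteq> j \<longrightarrow>
      prob {\<omega> \<in> space M. 10 \<le> card {l\<in>{1..n}. level \<delta> n \<le> \<bar>U l i \<omega> * V l j \<omega>\<bar>}} \<le> (real n * tail (level \<delta> n)) ^ 10"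
    using prob_many_large by (intro always_eventually) auto
  show "0 \<le> (real n * tail (level \<delta> n)) ^ 10" for n by (simp add: tail_nonneg)
  define f where "f = (\<lambda>n::nat. (real n)\<^sup>2 * (real n * sqrt (real n / ln (real n)) powr (-8/3)) ^ 10)"
  define D where "D = (real c)\<^sup>2 * (C * \<delta> powr (-8/3)) ^ 10"
  \<comment> \<open>Any exponent strictly between -4/3 and -1 absorbs the logarithms and is still
    summable.\<close>
  have "f \<in> O(\<lambda>n. real n powr (-7/6))" unfolding f_def by real_asymp
  moreover have "summable (\<lambda>n. norm (real n powr (-7/6)))" by (simp add: summable_real_powr_iff)
  ultimately have "summable f" by (rule summable_comparison_test_bigo[rotated])
  then have sum: "summable (\<lambda>n. D * f n)" by (rule summable_mult)
  have "filterlim (level \<delta>) at_top sequentially"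
    unfolding level_def[abs_def] using \<open>\<delta> > 0\<close> by real_asymp
  then have "\<forall>\<^sub>F n in sequentially. 1 \<le> level \<delta> n" by (simp add: filterlim_at_top)
  then have "\<forall>\<^sub>F n in sequentially. norm ((real (c * n))\<^sup>2 * (real n * tail (level \<delta> n)) ^ 10) \<le> D * f n"
    using eventually_ge_at_top[of 2]
  proof eventually_elim
    case (elim n)
    have "tail (level \<delta> n) \<le> C * level \<delta> n powr (-8/3)" using elim by (intro C)
    also have "\<dots> = C * \<delta> powr (-8/3) * sqrt (real n / ln (real n)) powr (-8/3)"
      using \<open>\<delta> > 0\<close> elim by (simp add: level_def powr_mult)
    finally have "(real n * tail (level \<delta> n)) ^ 10
        \<le> (real n * (C * \<delta> powr (-8/3) * sqrt (real n / ln (real n)) powr (-8/3))) ^ 10"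
      by (intro power_mono mult_left_mono) (auto simp: tail_nonneg)
    also have "\<dots> = (C * \<delta> powr (-8/3)) ^ 10 * (real n * sqrt (real n / ln (real n)) powr (-8/3)) ^ 10"
      unfolding power_mult_distrib[symmetric] by (intro arg_cong[where f = "\<lambda>x. x ^ 10"]) simp
    finally have "(real (c * n))\<^sup>2 * (real n * tail (level \<delta> n)) ^ 10
        \<le> (real (c * n))\<^sup>2 * ((C * \<delta> powr (-8/3)) ^ 10 * (real n * sqrt (real n / ln (real n)) powr (-8/3)) ^ 10)"
      by (intro mult_left_mono) auto
    also have "\<dots> = D * f n" unfolding D_def f_def of_nat_mult power_mult_distrib[of "real c"] by (simp only: mult_ac)
    finally show ?case by (simp add: tail_nonneg)
  qed
  then show "summable (\<lambda>n. (real (c * n))\<^sup>2 * (real n * tail (level \<delta> n)) ^ 10)"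
    by (rule summable_comparison_test_ev[OF _ sum])
qed

lemma measurable_sum_trunc:
  assumes "i \<ge> 1" "j \<ge> 1" "K \<subseteq> {1..}"
  shows "(\<lambda>\<omega>. \<Sum>k\<in>K. trunc b (U k i \<omega> * V k j \<omega>)) \<in> borel_measurable M"
  using assms by (intro borel_measurable_sum measurable_compose[OF measurable_UV measurable_trunc]) auto

text \<open>At time N = k^\<beta> the union over pairs leaves N^(-e), which is k to the power
  \<open>- (real \<beta> * e)\<close> and hence summable in k.\<close>

lemma AE_power_subsequence:
  assumes sq: "integrable M (\<lambda>\<omega>. (U 1 1 \<omega> * V 1 2 \<omega>)\<^sup>2)"
    and mean: "expectation (\<lambda>\<omega>. U 1 1 \<omega> * V 1 2 \<omega>) = 0"
    and var: "expectation (\<lambda>\<omega>. (U 1 1 \<omega> * V 1 2 \<omega>)\<^sup>2) = 1"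
    and "\<delta> > 0" "e > 0" and \<delta>: "exp (2 * \<delta>) < 1 + e / 2" and \<beta>: "\<beta> \<ge> 1" "real \<beta> * e \<ge> 2"
  shows "AE \<omega> in M. \<forall>\<^sub>F k in sequentially. \<forall>i\<in>{1..c * k ^ \<beta>}. \<forall>j\<in>{1..c * k ^ \<beta>}. i \<noteq> j \<longrightarrow>
    \<not> (2 + e) * thr (k ^ \<beta>) \<le> \<bar>\<Sum>l\<in>{1..k ^ \<beta>}. trunc (level \<delta> (k ^ \<beta>)) (U l i \<omega> * V l j \<omega>)\<bar>"
proof (rule AE_eventually_no_pair)
  fix k i j :: nat assume "i \<ge> 1" "j \<ge> 1"
  then have [measurable]: "(\<lambda>\<omega>. \<Sum>l\<in>{1..k ^ \<beta>}. trunc (level \<delta> (k ^ \<beta>)) (U l i \<omega> * V l j \<omega>)) \<in> borel_measurable M"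
    by (intro measurable_sum_trunc) auto
  show "{\<omega> \<in> space M. (2 + e) * thr (k ^ \<beta>) \<le> \<bar>\<Sum>l\<in>{1..k ^ \<beta>}. trunc (level \<delta> (k ^ \<beta>)) (U l i \<omega> * V l j \<omega>)\<bar>} \<in> sets M"
    by measurable
next
  \<comment> \<open>Tilting with parameter 2, the optimum for threshold 2. The exponent is 2 (2 + e)
    - 2 exp(2 \<delta>), and the hypothesis on \<open>\<delta>\<close> keeps it above 2 + e.\<close>
  have "2 + e < 2 * (2 + e) - 1 * (2\<^sup>2 / 2 * exp (2 * \<delta>))" using \<delta> by simp
  from eventually_prob_sum_trunc_ge[OF sq mean var \<open>\<delta> > 0\<close> _ _ this]
  have ev: "\<forall>\<^sub>F n in sequentially. \<forall>K i j. finite K \<and> K \<subseteq> {1..} \<and> real (card K) \<le> 1 * real n \<and> i \<ge> 1 \<and> j \<ge> 1 \<and> i \<noteq> j \<longrightarrow>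
    prob {\<omega> \<in> space M. (2 + e) * thr n \<le> \<bar>\<Sum>k\<in>K. trunc (level \<delta> n) (U k i \<omega> * V k j \<omega>)\<bar>} \<le> 2 * real n powr (- (2 + e))"
    by simp
  have "filterlim (\<lambda>k::nat. k ^ \<beta>) at_top sequentially"
  proof (rule filterlim_at_top_mono[OF filterlim_ident])
    show "\<forall>\<^sub>F k in sequentially. k \<le> k ^ \<beta>"
      using \<beta>(1) by (intro eventually_sequentiallyI[of 1] self_le_power) auto
  qed
  from eventually_compose_filterlim[OF ev this]
  show "\<forall>\<^sub>F k in sequentially. \<forall>i j. i \<ge> 1 \<and> j \<ge> 1 \<and> i \<noteq> j \<longrightarrow>
      prob {\<omega> \<in> space M. (2 + e) * thr (k ^ \<beta>) \<le> \<bar>\<Sum>l\<in>{1..k ^ \<beta>}. trunc (level \<delta> (k ^ \<beta>)) (U l i \<omega> * V l j \<omega>)\<bar>}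
      \<le> 2 * real (k ^ \<beta>) powr (- (2 + e))"
    by eventually_elim auto
  show "0 \<le> 2 * real (k ^ \<beta>) powr (- (2 + e))" for k by simp
  show "summable (\<lambda>k. (real (c * k ^ \<beta>))\<^sup>2 * (2 * real (k ^ \<beta>) powr (- (2 + e))))"
  proof (rule summable_comparison_test'[where N = 1])
    show "summable (\<lambda>k. 2 * (real c)\<^sup>2 * real k powr (-2))"
      by (intro summable_mult) (simp add: summable_real_powr_iff)
    fix k :: nat assume k: "k \<ge> 1"
    define N where "N = real (k ^ \<beta>)"
    have N: "N = real k powr real \<beta>" "N > 0" using k by (auto simp: N_def powr_realpow)
    have "N\<^sup>2 * N powr (- (2 + e)) = N powr (2 + - (2 + e))"
      using N(2) by (simp only: powr_add) simp
    also have "\<dots> = real k powr (- (real \<beta> * e))" by (simp add: N(1) powr_powr)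
    also have "\<dots> \<le> real k powr (-2)" using k \<beta>(2) by (intro powr_mono) auto
    finally have "N\<^sup>2 * N powr (- (2 + e)) \<le> real k powr (-2)" .
    then have "2 * (real c)\<^sup>2 * (N\<^sup>2 * N powr (- (2 + e))) \<le> 2 * (real c)\<^sup>2 * real k powr (-2)"
      by (intro mult_left_mono) auto
    moreover have "(real (c * k ^ \<beta>))\<^sup>2 * (2 * real (k ^ \<beta>) powr (- (2 + e))) = 2 * (real c)\<^sup>2 * (N\<^sup>2 * N powr (- (2 + e)))"
      unfolding N_def of_nat_mult by (simp only: power_mult_distrib mult_ac)
    ultimately show "norm ((real (c * k ^ \<beta>))\<^sup>2 * (2 * real (k ^ \<beta>) powr (- (2 + e)))) \<le> 2 * (real c)\<^sup>2 * real k powr (-2)"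
      by simp
  qed
qed

text \<open>Few rows mean a small variance, so the exponent can be raised until a union over all
  starting points \<open>m\<close>, all pairs and all \<open>n\<close> is affordable. This plays the
  part of a maximal inequality between the sparse times.\<close>

lemma AE_increments:
  assumes sq: "integrable M (\<lambda>\<omega>. (U 1 1 \<omega> * V 1 2 \<omega>)\<^sup>2)"
    and mean: "expectation (\<lambda>\<omega>. U 1 1 \<omega> * V 1 2 \<omega>) = 0"
    and var: "expectation (\<lambda>\<omega>. (U 1 1 \<omega> * V 1 2 \<omega>)\<^sup>2) = 1"
    and "\<delta> > 0" "e > 0"
  obtains \<eta> where "\<eta> > 0" and "AE \<omega> in M. \<forall>\<^sub>F n in sequentially. \<forall>i\<in>{1..c * n}. \<forall>j\<in>{1..c * n}. i \<noteq> j \<longrightarrow>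
    \<not> (\<exists>m\<in>{m\<in>{..n}. real (n - m) \<le> \<eta> * real n}.
        e * thr n \<le> \<bar>\<Sum>l\<in>{m + 1..n}. trunc (level \<delta> n) (U l i \<omega> * V l j \<omega>)\<bar>)"
proof -
  \<comment> \<open>This \<open>\<eta>\<close> costs 1/2 in the exponent, leaving more than 6, enough for the \<open>O(n ^ 3)\<close> choices of \<open>i\<close>, \<open>j\<close>, \<open>m\<close>.\<close>
  define \<alpha> where "\<alpha> = 7 / e"
  define \<eta> where "\<eta> = 1 / (\<alpha>\<^sup>2 * exp (\<alpha> * \<delta>))"
  have \<alpha>: "\<alpha> > 0" "\<alpha> * e = 7" using \<open>e > 0\<close> by (auto simp: \<alpha>_def)
  then have \<eta>: "\<eta> > 0" by (simp add: \<eta>_def)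
  have "\<eta> * (\<alpha>\<^sup>2 / 2 * exp (\<alpha> * \<delta>)) = 1 / 2" using \<alpha> by (simp add: \<eta>_def)
  then have "6 < \<alpha> * e - \<eta> * (\<alpha>\<^sup>2 / 2 * exp (\<alpha> * \<delta>))" using \<alpha> by simp
  note ev = eventually_prob_sum_trunc_ge[OF sq mean var \<open>\<delta> > 0\<close> \<alpha>(1) \<eta> this]
  define J where "J = (\<lambda>n::nat. {m\<in>{..n}. real (n - m) \<le> \<eta> * real n})"
  have "AE \<omega> in M. \<forall>\<^sub>F n in sequentially. \<forall>i\<in>{1..c * n}. \<forall>j\<in>{1..c * n}. i \<noteq> j \<longrightarrow>
    \<not> (\<exists>m\<in>J n. e * thr n \<le> \<bar>\<Sum>l\<in>{m + 1..n}. trunc (level \<delta> n) (U l i \<omega> * V l j \<omega>)\<bar>)"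
  proof (rule AE_eventually_no_pair)
    have eq: "{\<omega> \<in> space M. \<exists>m\<in>J n. e * thr n \<le> \<bar>\<Sum>l\<in>{m + 1..n}. trunc (level \<delta> n) (U l i \<omega> * V l j \<omega>)\<bar>}
        = (\<Union>m\<in>J n. {\<omega> \<in> space M. e * thr n \<le> \<bar>\<Sum>l\<in>{m + 1..n}. trunc (level \<delta> n) (U l i \<omega> * V l j \<omega>)\<bar>})" for n i j
      by auto
    have fin: "finite (J n)" "card (J n) \<le> n + 1" for n
      using card_mono[of "{..n}" "J n"] by (auto simp: J_def)
    have ms: "{\<omega> \<in> space M. e * thr n \<le> \<bar>\<Sum>l\<in>{m + 1..n}. trunc (level \<delta> n) (U l i \<omega> * V l j \<omega>)\<bar>} \<in> sets M"
      if "i \<ge> 1" "j \<ge> 1" for n m i j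
    proof -
      have [measurable]: "(\<lambda>\<omega>. \<Sum>l\<in>{m + 1..n}. trunc (level \<delta> n) (U l i \<omega> * V l j \<omega>)) \<in> borel_measurable M"
        using that by (intro measurable_sum_trunc) auto
      show ?thesis by measurable
    qed
    show "{\<omega> \<in> space M. \<exists>m\<in>J n. e * thr n \<le> \<bar>\<Sum>l\<in>{m + 1..n}. trunc (level \<delta> n) (U l i \<omega> * V l j \<omega>)\<bar>} \<in> sets M"
      if "i \<ge> 1" "j \<ge> 1" for n i j
      unfolding eq using that fin by (intro sets.finite_UN ms) auto
    show "\<forall>\<^sub>F n in sequentially. \<forall>i j. i \<ge> 1 \<and> j \<ge> 1 \<and> i \<noteq> j \<longrightarrow>
      prob {\<omega> \<in> space M. \<exists>m\<in>J n. e * thr n \<le> \<bar>\<Sum>l\<in>{m + 1..n}. trunc (level \<delta> n) (U l i \<omega> * V l j \<omega>)\<bar>}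
      \<le> real (n + 1) * (2 * real n powr (-6))"
      using ev
    proof eventually_elim
      case (elim n)
      show ?case
      proof (intro allI impI)
        fix i j :: nat assume ij: "i \<ge> 1 \<and> j \<ge> 1 \<and> i \<noteq> j"
        have "prob {\<omega> \<in> space M. \<exists>m\<in>J n. e * thr n \<le> \<bar>\<Sum>l\<in>{m + 1..n}. trunc (level \<delta> n) (U l i \<omega> * V l j \<omega>)\<bar>}
            \<le> (\<Sum>m\<in>J n. prob {\<omega> \<in> space M. e * thr n \<le> \<bar>\<Sum>l\<in>{m + 1..n}. trunc (level \<delta> n) (U l i \<omega> * V l j \<omega>)\<bar>})"
          unfolding eq using ij fin by (intro measure_UNION_le ms) auto
        also have "\<dots> \<le> (\<Sum>m\<in>J n. 2 * real n powr (-6))"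
        proof (rule sum_mono)
          fix m assume "m \<in> J n"
          then have "finite {m + 1..n} \<and> {m + 1..n} \<subseteq> {1..} \<and> real (card {m + 1..n}) \<le> \<eta> * real n"
            by (auto simp: J_def)
          then show "prob {\<omega> \<in> space M. e * thr n \<le> \<bar>\<Sum>l\<in>{m + 1..n}. trunc (level \<delta> n) (U l i \<omega> * V l j \<omega>)\<bar>}
              \<le> 2 * real n powr (-6)"
            using elim ij by blast
        qed
        also have "\<dots> = real (card (J n)) * (2 * real n powr (-6))" by simp
        also have "\<dots> \<le> real (n + 1) * (2 * real n powr (-6))"
          using fin(2)[of n] by (intro mult_right_mono) (auto simp del: of_nat_add of_nat_Suc)
        finally show "prob {\<omega> \<in> space M. \<exists>m\<in>J n. e * thr n \<le> \<bar>\<Sum>l\<in>{m + 1..n}. trunc (level \<delta> n) (U l i \<omega> * V l j \<omega>)\<bar>}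
            \<le> real (n + 1) * (2 * real n powr (-6))" .
      qed
    qed
    have "(\<lambda>n. (real n)\<^sup>2 * (real (n + 1) * (2 * real n powr (-6)))) \<in> O(\<lambda>n. real n powr (-2))"
      by real_asymp
    then have "summable (\<lambda>n. (real n)\<^sup>2 * (real (n + 1) * (2 * real n powr (-6))))"
      by (rule summable_comparison_test_bigo[rotated]) (simp add: summable_real_powr_iff)
    then have "summable (\<lambda>n. (real c)\<^sup>2 * ((real n)\<^sup>2 * (real (n + 1) * (2 * real n powr (-6)))))"
      by (rule summable_mult)
    then show "summable (\<lambda>n. (real (c * n))\<^sup>2 * (real (n + 1) * (2 * real n powr (-6))))"
      unfolding of_nat_mult power_mult_distrib[of "real c"] by (simp only: mult.assoc)
    show "0 \<le> real (n + 1) * (2 * real n powr (-6))" for n by simp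
  qed
  then show thesis using \<eta> by (intro that[of \<eta>]) (auto simp: J_def)
qed

lemma AE_eventually_Tstat_le:
  assumes sum: "summable (\<lambda>n. rowmax_prob n (thr n))"
    and sq: "integrable M (\<lambda>\<omega>. (U 1 1 \<omega> * V 1 2 \<omega>)\<^sup>2)"
    and mean: "expectation (\<lambda>\<omega>. U 1 1 \<omega> * V 1 2 \<omega>) = 0"
    and var: "expectation (\<lambda>\<omega>. (U 1 1 \<omega> * V 1 2 \<omega>)\<^sup>2) = 1"
    and p: "\<And>n. n \<ge> 1 \<Longrightarrow> p n \<le> A * n" and "\<epsilon> > 0"
  shows "AE \<omega> in M. \<forall>\<^sub>F n in sequentially. Tstat U V p n \<omega> \<le> (2 + \<epsilon>) * thr n"
proof -
  \<comment> \<open>Two truncated sums cost \<open>(2 + e) + e\<close>, and the at most 9 large products in each cost \<open>9 * e\<close>.\<close>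
  define e where "e = \<epsilon> / 20"
  \<comment> \<open>The divisor 4 makes exp(2 \<delta>) the square root of 1 + e/2, hence strictly
    smaller than 1 + e/2.\<close>
  define \<delta> where "\<delta> = ln (1 + e / 2) / 4"
  \<comment> \<open>The columns of time \<open>n\<close> must already be controlled at an earlier
    time N with n <= 2 N; then \<open>p n \<le> A * n\<close> is at most 2 A N.\<close>
  define c where "c = 2 * A"
  have e: "e > 0" using \<open>\<epsilon> > 0\<close> by (simp add: e_def)
  have \<delta>: "\<delta> > 0" using e by (simp add: \<delta>_def)
  have exp\<delta>: "exp (2 * \<delta>) < 1 + e / 2"
  proof -
    have "2 * \<delta> < ln (1 + e / 2)" using \<delta> unfolding \<delta>_def by linarith
    then have "exp (2 * \<delta>) < exp (ln (1 + e / 2))" by simp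
    also have "\<dots> = 1 + e / 2" using e by simp
    finally show ?thesis .
  qed
  obtain \<beta> :: nat where \<beta>: "\<beta> \<ge> 1" "real \<beta> * e \<ge> 2"
  proof -
    obtain \<beta>' :: nat where "2 / e \<le> real \<beta>'" using real_arch_simple by blast
    then have "2 / e \<le> real (\<beta>' + 1)" by simp
    then have "2 \<le> real (\<beta>' + 1) * e" using e by (simp add: field_simps)
    then show thesis by (intro that[of "\<beta>' + 1"]) auto
  qed
  obtain C where C: "C \<ge> 0" "\<And>y. y \<ge> 1 \<Longrightarrow> tail y \<le> C * y powr (-8/3)"
    using tail_bound[OF sum] by blast
  have E2: "AE \<omega> in M. \<forall>\<^sub>F n in sequentially. \<forall>i\<in>{1..c * n}. \<forall>j\<in>{1..c * n}. i \<noteq> j \<longrightarrow>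
    \<not> 10 \<le> card {l\<in>{1..n}. level \<delta> n \<le> \<bar>U l i \<omega> * V l j \<omega>\<bar>}"
    by (rule AE_few_large[OF C(1) _ \<delta>]) (rule C(2))
  obtain \<eta> where \<eta>: "\<eta> > 0" and E3: "AE \<omega> in M. \<forall>\<^sub>F n in sequentially. \<forall>i\<in>{1..c * n}. \<forall>j\<in>{1..c * n}. i \<noteq> j \<longrightarrow>
    \<not> (\<exists>m\<in>{m\<in>{..n}. real (n - m) \<le> \<eta> * real n}.
        e * thr n \<le> \<bar>\<Sum>l\<in>{m + 1..n}. trunc (level \<delta> n) (U l i \<omega> * V l j \<omega>)\<bar>)"
    using AE_increments[OF sq mean var \<delta> e] by blast
  \<comment> \<open>The ratio of consecutive times tends to 1. The bound 1 in the minimum yields n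
    <= 2 N; the bound \<open>\<eta>\<close> leaves few enough rows after N for the increment
    estimate.\<close>
  have "(\<lambda>k. (1 + 1 / real k) ^ \<beta>) \<longlonglongrightarrow> (1 + 0) ^ \<beta>"
    by (intro tendsto_intros lim_const_over_n)
  then have "\<forall>\<^sub>F k in sequentially. (1 + 1 / real k) ^ \<beta> < 1 + min 1 \<eta>"
    by (rule order_tendstoD(2)) (use \<eta> in auto)
  then obtain K0 where K0: "\<And>k. k \<ge> K0 \<Longrightarrow> (1 + 1 / real k) ^ \<beta> < 1 + min 1 \<eta>"
    by (auto simp: eventually_sequentially)
  show ?thesis
    using AE_products_le[OF sum e, of c] E2 E3
      AE_power_subsequence[OF sq mean var \<delta> e exp\<delta> \<beta>, of c]
  proof eventually_elim
    case (elim \<omega>)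
    define z where "z = (\<lambda>i j l. U l i \<omega> * V l j \<omega>)"
    obtain N1 where N1: "\<And>n l i j. n \<ge> N1 \<Longrightarrow> l \<in> {1..n} \<Longrightarrow> i \<in> {1..c * n} \<Longrightarrow> j \<in> {1..c * n} \<Longrightarrow> i \<noteq> j \<Longrightarrow>
        \<bar>z i j l\<bar> \<le> e * thr n"
      using elim(1) unfolding eventually_sequentially z_def by blast
    obtain N2 where N2: "\<And>n i j. n \<ge> N2 \<Longrightarrow> i \<in> {1..c * n} \<Longrightarrow> j \<in> {1..c * n} \<Longrightarrow> i \<noteq> j \<Longrightarrow>
        \<not> 10 \<le> card {l\<in>{1..n}. level \<delta> n \<le> \<bar>z i j l\<bar>}"
      using elim(2) unfolding eventually_sequentially z_def by blast
    obtain N3 where N3: "\<And>n i j m. n \<ge> N3 \<Longrightarrow> i \<in> {1..c * n} \<Longrightarrow> j \<in> {1..c * n} \<Longrightarrow> i \<noteq> j \<Longrightarrow>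
        m \<le> n \<Longrightarrow> real (n - m) \<le> \<eta> * real n \<Longrightarrow> \<not> e * thr n \<le> \<bar>\<Sum>l\<in>{m + 1..n}. trunc (level \<delta> n) (z i j l)\<bar>"
      using elim(3) unfolding eventually_sequentially z_def by blast
    obtain N4 where N4: "\<And>k i j. k \<ge> N4 \<Longrightarrow> i \<in> {1..c * k ^ \<beta>} \<Longrightarrow> j \<in> {1..c * k ^ \<beta>} \<Longrightarrow> i \<noteq> j \<Longrightarrow>
        \<not> (2 + e) * thr (k ^ \<beta>) \<le> \<bar>\<Sum>l\<in>{1..k ^ \<beta>}. trunc (level \<delta> (k ^ \<beta>)) (z i j l)\<bar>"
      using elim(4) unfolding eventually_sequentially z_def by blast
    \<comment> \<open>Since K <= k <= N <= n, this one sum lets every starting index be used at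
      whichever of k, N, n is needed.\<close>
    define K where "K = N1 + N2 + N3 + N4 + K0 + 1"
    show ?case
    proof (rule eventually_sequentiallyI[of "K ^ \<beta>"])
      fix n assume n: "K ^ \<beta> \<le> n"
      obtain k where k: "k ^ \<beta> \<le> n" "n < (k + 1) ^ \<beta>" using ex_root_interval[OF \<beta>(1)] by blast
      define N where "N = k ^ \<beta>"
      have "K < k + 1"
      proof (rule ccontr)
        assume "\<not> K < k + 1"
        then have "(k + 1) ^ \<beta> \<le> K ^ \<beta>" by (intro power_mono) auto
        then show False using k n by simp
      qed
      then have kK: "k \<ge> K" by simp
      have "k \<ge> 1" using kK by (simp add: K_def)
      have "k \<le> N" unfolding N_def using \<open>k \<ge> 1\<close> \<beta>(1) by (intro self_le_power) auto
      then have N: "N \<ge> K" "N \<le> n" using kK k by (auto simp: N_def)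
      have ratio: "real n \<le> (1 + min 1 \<eta>) * real N"
      proof -
        have "real n \<le> real ((k + 1) ^ \<beta>)" using k(2) by linarith
        also have "\<dots> = (1 + 1 / real k) ^ \<beta> * real N"
          using \<open>k \<ge> 1\<close> by (simp add: N_def power_mult_distrib[symmetric] field_simps)
        also have "\<dots> \<le> (1 + min 1 \<eta>) * real N"
          using K0[of k] kK by (intro mult_right_mono) (auto simp: K_def)
        finally show ?thesis .
      qed
      have "(1 + min 1 \<eta>) * real N \<le> 2 * real N" by (intro mult_right_mono) auto
      then have n2N: "n \<le> 2 * N" using ratio by linarith
      have "min 1 \<eta> * real N \<le> \<eta> * real n" using N \<eta> by (intro mult_mono) auto
      then have inc: "real (n - N) \<le> \<eta> * real n" using ratio N by (simp add: of_nat_diff algebra_simps)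
      have "n \<ge> 1" using N by (simp add: K_def)
      show "Tstat U V p n \<omega> \<le> (2 + \<epsilon>) * thr n"
      proof (rule Tstat_le)
        show "0 \<le> (2 + \<epsilon>) * thr n" using \<open>\<epsilon> > 0\<close> by (simp add: thr_nonneg)
        fix i j assume ij: "i \<in> {1..p n}" "j \<in> {1..p n}" "i \<noteq> j"
        have "A * n \<le> A * (2 * N)" using n2N by (intro mult_left_mono) auto
        also have "\<dots> = c * N" by (simp add: c_def)
        finally have pN: "p n \<le> c * N" using p[OF \<open>n \<ge> 1\<close>] by linarith
        have "c * N \<le> c * n" using N by (intro mult_left_mono) auto
        then have ijN: "i \<in> {1..c * N}" "j \<in> {1..c * N}" and ijn: "i \<in> {1..c * n}" "j \<in> {1..c * n}"
          using ij pN unfolding atLeastAtMost_iff by linarith+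
        have "\<bar>\<Sum>l\<in>{1..N}. z i j l\<bar> \<le> \<bar>\<Sum>l\<in>{1..N}. trunc (level \<delta> N) (z i j l)\<bar> + real 9 * (e * thr N)"
        proof (rule abs_sum_le_trunc[of _ N])
          show "card {l\<in>{1..N}. level \<delta> N \<le> \<bar>z i j l\<bar>} \<le> 9"
            using N2[of N i j] N ijN ij(3) by (simp add: K_def)
          show "\<bar>z i j l\<bar> \<le> e * thr N" if "l \<in> {1..N}" for l
            using N1[of N l i j] N ijN ij(3) that by (simp add: K_def)
        qed (use e in \<open>auto simp: thr_nonneg\<close>)
        also have "\<bar>\<Sum>l\<in>{1..N}. trunc (level \<delta> N) (z i j l)\<bar> \<le> (2 + e) * thr N"
          using N4[of k i j] kK ijN ij(3) by (simp add: K_def N_def)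
        also have "(2 + e) * thr N + real 9 * (e * thr N) = (2 + 10 * e) * thr N" by (simp add: algebra_simps)
        also have "\<dots> \<le> (2 + 10 * e) * thr n" using N e by (intro mult_left_mono thr_mono) auto
        finally have S1: "\<bar>\<Sum>l\<in>{1..N}. z i j l\<bar> \<le> (2 + 10 * e) * thr n" by simp
        \<comment> \<open>This part is truncated at the level of time \<open>n\<close>, the first
          part at the level of time \<open>N\<close>; the count of large products is therefore
          invoked at each time separately.\<close>
        have "\<bar>\<Sum>l\<in>{N + 1..n}. z i j l\<bar> \<le> \<bar>\<Sum>l\<in>{N + 1..n}. trunc (level \<delta> n) (z i j l)\<bar> + real 9 * (e * thr n)"
        proof (rule abs_sum_le_trunc[of _ n])
          show "card {l\<in>{1..n}. level \<delta> n \<le> \<bar>z i j l\<bar>} \<le> 9"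
            using N2[of n i j] N ijn ij(3) by (simp add: K_def)
          show "\<bar>z i j l\<bar> \<le> e * thr n" if "l \<in> {N + 1..n}" for l
            using N1[of n l i j] N ijn ij(3) that by (simp add: K_def)
        qed (use e in \<open>auto simp: thr_nonneg\<close>)
        moreover have "\<bar>\<Sum>l\<in>{N + 1..n}. trunc (level \<delta> n) (z i j l)\<bar> \<le> e * thr n"
          using N3[of n i j N] N ijn ij(3) inc by (simp add: K_def)
        ultimately have S2: "\<bar>\<Sum>l\<in>{N + 1..n}. z i j l\<bar> \<le> 10 * e * thr n" by simp
        have "{1..n} = {1..N} \<union> {N + 1..n}" using N by auto
        then have "(\<Sum>l=1..n. z i j l) = (\<Sum>l\<in>{1..N}. z i j l) + (\<Sum>l\<in>{N + 1..n}. z i j l)"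
          by (simp only:) (rule sum.union_disjoint; auto)
        then have "\<bar>\<Sum>l=1..n. z i j l\<bar> \<le> (2 + 10 * e) * thr n + 10 * e * thr n" using S1 S2 by linarith
        also have "\<dots> = (2 + \<epsilon>) * thr n" by (simp add: e_def algebra_simps)
        finally show "\<bar>\<Sum>l=1..n. U l i \<omega> * V l j \<omega>\<bar> \<le> (2 + \<epsilon>) * thr n" by (simp add: z_def)
      qed
    qed
  qed
qed

text \<open>The exceptional null set depends on the margin, hence the countable family of margins 1
  / (q + 1).\<close>

lemma AE_limsup_le_2:
  assumes "\<And>\<epsilon>. \<epsilon> > 0 \<Longrightarrow> AE \<omega> in M. \<forall>\<^sub>F n in sequentially. T n \<omega> \<le> (2 + \<epsilon>) * thr n"
  shows "AE \<omega> in M. limsup (\<lambda>n. ereal (T n \<omega> / thr n)) \<le> 2"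
proof -
  have "AE \<omega> in M. \<forall>q. \<forall>\<^sub>F n in sequentially. T n \<omega> \<le> (2 + 1 / real (Suc q)) * thr n"
    by (subst AE_all_countable) (auto intro!: assms)
  then show ?thesis
  proof eventually_elim
    case (elim \<omega>)
    have "limsup (\<lambda>n. ereal (T n \<omega> / thr n)) \<le> ereal (2 + 1 / real (Suc q))" for q
    proof (rule Limsup_bounded)
      show "\<forall>\<^sub>F n in sequentially. ereal (T n \<omega> / thr n) \<le> ereal (2 + 1 / real (Suc q))"
        using elim[rule_format, of q] eventually_ge_at_top[of 2]
      proof eventually_elim
        case (elim n)
        then show ?case using thr_pos[of n] by (simp add: pos_divide_le_eq)
      qed
    qed
    moreover have "(\<lambda>q. ereal (2 + 1 / real (Suc q))) \<longlonglongrightarrow> ereal (2 + 0)"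
      by (intro tendsto_ereal tendsto_add tendsto_const LIMSEQ_Suc[OF lim_const_over_n])
    ultimately show ?case
      using LIMSEQ_le_const[of "\<lambda>q. ereal (2 + 1 / real (Suc q))" "ereal (2 + 0)"] by auto
  qed
qed

section \<open>From moments of the product back to moments of its factors\<close>

lemma nn_integral_product_square:
  "(\<integral>\<^sup>+\<omega>. ennreal ((U 1 1 \<omega> * V 1 2 \<omega>)\<^sup>2) \<partial>M)
    = (\<integral>\<^sup>+\<omega>. ennreal ((U 1 1 \<omega>)\<^sup>2) \<partial>M) * (\<integral>\<^sup>+\<omega>. ennreal ((V 1 1 \<omega>)\<^sup>2) \<partial>M)"
proof -
  have "ennreal ((U 1 1 \<omega> * V 1 2 \<omega>)\<^sup>2) = ennreal ((U 1 1 \<omega>)\<^sup>2) * ennreal ((V 1 2 \<omega>)\<^sup>2)" for \<omega>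
    by (simp only: power_mult_distrib ennreal_mult zero_le_power2)
  then show ?thesis using nn_integral_factor[of "\<lambda>x. ennreal (x\<^sup>2)" "\<lambda>x. ennreal (x\<^sup>2)"] by simp
qed

text \<open>A finite product of second moments allows one to be 0 and the other infinite. In that
  case one variable vanishes almost surely and both sides are 0, whatever value the integral of the
  other has; otherwise both second moments are finite and the expectations factor.\<close>

lemma expectation_product_factor:
  assumes "(\<integral>\<^sup>+\<omega>. ennreal ((U 1 1 \<omega>)\<^sup>2) \<partial>M) * (\<integral>\<^sup>+\<omega>. ennreal ((V 1 1 \<omega>)\<^sup>2) \<partial>M) < \<infinity>"
  shows "expectation (U 1 1) * expectation (V 1 1) = expectation (\<lambda>\<omega>. U 1 1 \<omega> * V 1 2 \<omega>)"
proof -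
  define a where "a = (\<integral>\<^sup>+\<omega>. ennreal ((U 1 1 \<omega>)\<^sup>2) \<partial>M)"
  define b where "b = (\<integral>\<^sup>+\<omega>. ennreal ((V 1 1 \<omega>)\<^sup>2) \<partial>M)"
  have Um: "U 1 1 \<in> borel_measurable M" and Vm: "V 1 1 \<in> borel_measurable M"
    using measurable_U[of 1 1] measurable_V[of 1 1] by auto
  have Zm: "(\<lambda>\<omega>. U 1 1 \<omega> * V 1 2 \<omega>) \<in> borel_measurable M" by (rule measurable_UV) auto
  have null: "AE \<omega> in M. f \<omega> = 0" if "(\<integral>\<^sup>+\<omega>. ennreal ((f \<omega>)\<^sup>2) \<partial>M) = 0" "f \<in> borel_measurable M" for f
    using that by (subst (asm) nn_integral_0_iff_AE) auto
  have zero: "expectation f = 0" if "AE \<omega> in M. f \<omega> = 0" for f :: "'a \<Rightarrow> real"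
  proof (cases "f \<in> borel_measurable M")
    case True
    then have "expectation f = expectation (\<lambda>\<omega>. 0)" using that by (intro integral_cong_AE) auto
    then show ?thesis by simp
  next
    case False
    \<comment> \<open>A function that is not measurable is not integrable, and its integral is 0 by
      convention.\<close>
    then show ?thesis by (intro not_integrable_integral_eq) auto
  qed
  show ?thesis
  proof (cases "a = 0 \<or> b = 0")
    case True
    then have "(\<integral>\<^sup>+\<omega>. ennreal ((U 1 1 \<omega> * V 1 2 \<omega>)\<^sup>2) \<partial>M) = 0"
      unfolding nn_integral_product_square a_def b_def by auto
    then have "expectation (\<lambda>\<omega>. U 1 1 \<omega> * V 1 2 \<omega>) = 0" by (intro zero null Zm)
    moreover have "expectation (U 1 1) = 0 \<or> expectation (V 1 1) = 0"
      using True zero[OF null[OF _ Um]] zero[OF null[OF _ Vm]] unfolding a_def b_def by auto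
    ultimately show ?thesis by auto
  next
    case False
    then have "a < \<infinity>" "b < \<infinity>" using assms unfolding a_def[symmetric] b_def[symmetric]
      by (auto simp: ennreal_mult_eq_top_iff less_top[symmetric] ennreal_top_mult ennreal_mult_top)
    then have "integrable M (\<lambda>\<omega>. (U 1 1 \<omega>)\<^sup>2)" "integrable M (\<lambda>\<omega>. (V 1 1 \<omega>)\<^sup>2)"
      unfolding a_def b_def using Um Vm by (auto intro!: integrableI_nonneg)
    then show ?thesis using square_integrable_imp_integrable Um Vm expectation_factor by metis
  qed
qed

end

theorem theorem3p3:
  fixes M :: "'a measure" and U V :: "nat \<Rightarrow> nat \<Rightarrow> 'a \<Rightarrow> real" and p :: "nat \<Rightarrow> nat"
  assumes "prob_space M"
    and indep: "prob_space.indep_vars M (\<lambda>_. borel)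
          (\<lambda>ki \<omega>. (U (fst ki) (snd ki) \<omega>, V (fst ki) (snd ki) \<omega>)) ({1..} \<times> {1..})"
    and ident: "\<And>k i. k \<ge> 1 \<Longrightarrow> i \<ge> 1 \<Longrightarrow>
          distr M borel (\<lambda>\<omega>. (U k i \<omega>, V k i \<omega>)) = distr M borel (\<lambda>\<omega>. (U 1 1 \<omega>, V 1 1 \<omega>))"
    and ppos: "\<And>n. n \<ge> 1 \<Longrightarrow> p n > 0"
    and pbd: "\<exists>a b. 0 < a \<and> (\<forall>n\<ge>1. a \<le> real n / real (p n) \<and> real n / real (p n) \<le> b)"
  shows
   "(((\<integral>\<omega>. U 1 1 \<omega> \<partial>M) * (\<integral>\<omega>. V 1 1 \<omega> \<partial>M) = 0
       \<and> (\<integral>\<^sup>+\<omega>. ennreal ((U 1 1 \<omega>)\<^sup>2) \<partial>M) * (\<integral>\<^sup>+\<omega>. ennreal ((V 1 1 \<omega>)\<^sup>2) \<partial>M) = 1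
       \<and> summable (\<lambda>n. measure M {\<omega> \<in> space M. Mstat U V n \<omega> \<ge> sqrt (real n * ln (real n))}))
      \<longrightarrow> (AE \<omega> in M. limsup (\<lambda>n. ereal (Tstat U V p n \<omega> / sqrt (real n * ln (real n)))) \<le> 2))
    \<and> ((AE \<omega> in M. limsup (\<lambda>n. ereal (Tstat U V p n \<omega> / sqrt (real n * ln (real n)))) < \<infinity>)
      \<longrightarrow> ((\<integral>\<omega>. U 1 1 \<omega> \<partial>M) * (\<integral>\<omega>. V 1 1 \<omega> \<partial>M) = 0
       \<and> (\<integral>\<^sup>+\<omega>. ennreal ((U 1 1 \<omega>)\<^sup>2) \<partial>M) * (\<integral>\<^sup>+\<omega>. ennreal ((V 1 1 \<omega>)\<^sup>2) \<partial>M) < \<infinity>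
       \<and> summable (\<lambda>n. measure M {\<omega> \<in> space M. Mstat U V n \<omega> \<ge> sqrt (real n * ln (real n))})))"
proof -
  interpret prob_space M by fact
  interpret iid_pairs M U V
    by unfold_locales (fact indep, fact ident)
  obtain a b where ab: "0 < a" "\<And>n. n \<ge> 1 \<Longrightarrow> a \<le> real n / real (p n) \<and> real n / real (p n) \<le> b"
    using pbd by blast
  \<comment> \<open>The lower bound on n / p_n limits the number of columns, as part (a) requires;
    the upper bound ensures that there are enough of them for part (b).\<close>
  obtain A :: nat where A: "1 / a \<le> real A" using real_arch_simple by blast
  have pA: "p n \<le> A * n" if n: "n \<ge> 1" for n
  proof -
    have "a * real (p n) \<le> real n" using ab(2)[OF n] ppos[OF n] by (simp add: field_simps)
    then have "real (p n) \<le> (1 / a) * real n" using ab(1) by (simp add: field_simps)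
    also have "\<dots> \<le> real A * real n" using A by (intro mult_right_mono) auto
    finally show ?thesis by (metis of_nat_le_iff of_nat_mult)
  qed
  show ?thesis
    unfolding thr_def[symmetric] summable_Mstat_iff
  proof (intro conjI impI; (elim conjE)?)
    assume mean: "expectation (U 1 1) * expectation (V 1 1) = 0"
      and var: "(\<integral>\<^sup>+\<omega>. ennreal ((U 1 1 \<omega>)\<^sup>2) \<partial>M) * (\<integral>\<^sup>+\<omega>. ennreal ((V 1 1 \<omega>)\<^sup>2) \<partial>M) = 1"
      and sum: "summable (\<lambda>n. rowmax_prob n (thr n))"
    have nn: "(\<integral>\<^sup>+\<omega>. ennreal ((U 1 1 \<omega> * V 1 2 \<omega>)\<^sup>2) \<partial>M) = 1"
      unfolding nn_integral_product_square by (rule var)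
    have Zm: "(\<lambda>\<omega>. U 1 1 \<omega> * V 1 2 \<omega>) \<in> borel_measurable M" by (rule measurable_UV) auto
    have sq: "integrable M (\<lambda>\<omega>. (U 1 1 \<omega> * V 1 2 \<omega>)\<^sup>2)"
      using nn Zm by (intro integrableI_nonneg) auto
    have var': "expectation (\<lambda>\<omega>. (U 1 1 \<omega> * V 1 2 \<omega>)\<^sup>2) = 1"
      using nn Zm by (subst integral_eq_nn_integral) auto
    have mean': "expectation (\<lambda>\<omega>. U 1 1 \<omega> * V 1 2 \<omega>) = 0"
      using expectation_product_factor[unfolded var] mean by simp
    show "AE \<omega> in M. limsup (\<lambda>n. ereal (Tstat U V p n \<omega> / thr n)) \<le> 2"
      by (rule AE_limsup_le_2) (rule AE_eventually_Tstat_le[OF sum sq mean' var' pA])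
  next
    assume lim: "AE \<omega> in M. limsup (\<lambda>n. ereal (Tstat U V p n \<omega> / thr n)) < \<infinity>"
    note conv = limsup_finite_imp[OF ab lim]
    show fin: "(\<integral>\<^sup>+\<omega>. ennreal ((U 1 1 \<omega>)\<^sup>2) \<partial>M) * (\<integral>\<^sup>+\<omega>. ennreal ((V 1 1 \<omega>)\<^sup>2) \<partial>M) < \<infinity>"
      using conv(2) unfolding nn_integral_product_square .
    show "expectation (U 1 1) * expectation (V 1 1) = 0"
      using expectation_product_factor[OF fin] conv(3) by simp
    show "summable (\<lambda>n. rowmax_prob n (thr n))" by (rule conv(1))
  qed
qed

end
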